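(* Let $\Gamma$ be a connected graph, $G\subset\Gamma$ a (not necessarily connected) subgraph, and suppose $h_1(G)>0$. Then the linear space $L(G):A_e=0,\ e\in G$, is contained in $X_\Gamma$. Let $P\to\mathbb{P}(E_\Gamma)$ be the blowup of $L(G)\subset\mathbb{P}(E_\Gamma)$, and let $F\subset P$ be the exceptional locus. Let $Y\subset P$ be the strict transform of $X_\Gamma$ in $P$. Then there are canonical identifications $$F\cong\mathbb{P}(E_G)\times\mathbb{P}(E_{\Gamma//G}),$$ $$Y\cap F=\big(X_G\times\mathbb{P}(E_{\Gamma//G})\big)\cup\big(\mathbb{P}(E_G)\times X_{\Gamma//G}\big).$$
   Context: Graphs are finite; subgraphs are identified with their edge sets (no isolated vertices); $h_1$ is the first Betti number. For a graph $\Gamma$ with edge set $E_\Gamma$, $\mathbb{P}(E_\Gamma)$ is the projective space of dimension $\#E_\Gamma-1$ over a field $K$ with homogeneous coordinates $A_e$, $e\in E_\Gamma$. The graph polynomial is $\Psi_\Gamma=\sum_T\prod_{e\notin T}A_e$, the sum over spanning trees $T$ (for disconnected graphs, a "spanning tree" is a subgraph whose intersection with each connected component is a spanning tree of that component, so $\Psi$ is the product over components); a single vertex counts as a tree. $X_\Gamma\subset\mathbb{P}(E_\Gamma)$ is the hypersurface $\Psi_\Gamma=0$ (empty if $\Psi_\Gamma=1$). $\Gamma//G$ is the graph obtained from $\Gamma$ by contracting each connected component $G_i$ of $G$ to its own vertex $v_i$ (distinct components giving distinct vertices); its edge set is $E_{\Gamma//G}=E_\Gamma\setminus E_G$. *)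

theory Defs
  imports
    "Graph_Theory.Digraph_Component"
    "HOL-Library.Poly_Mapping"
    "HOL-Library.FuncSet"
    "HOL-Algebra.Ideal"
begin

section \<open>Graphs\<close>

text \<open>
  A graph is a finite multigraph, loops allowed. It is represented by a \<^const>\<open>fin_digraph\<close>, i.e.
  with an arbitrary orientation of every edge. The orientation only serves to write down the
  boundary map: connectedness (\<^const>\<open>connected\<close>) refers to the underlying undirected graph. The
  library notions \<^const>\<open>forest\<close>, \<^const>\<open>tree\<close> and \<^const>\<open>spanning_tree\<close> are not used, since they
  only exclude directed cycles.
\<close>

definition edge_boundary :: "('a,'e) pre_digraph \<Rightarrow> ('e \<Rightarrow>\<^sub>0 rat) \<Rightarrow> ('a \<Rightarrow>\<^sub>0 rat)" where
  "edge_boundary \<Gamma> c = (\<Sum>e\<in>Poly_Mapping.keys c.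
     Poly_Mapping.single (head \<Gamma> e) (Poly_Mapping.lookup c e)
     - Poly_Mapping.single (tail \<Gamma> e) (Poly_Mapping.lookup c e))"

text \<open>First homology with rational coefficients, and its dimension, the first Betti number.\<close>

definition H1 :: "('a,'e) pre_digraph \<Rightarrow> ('e \<Rightarrow>\<^sub>0 rat) set" where
  "H1 \<Gamma> = {c. Poly_Mapping.keys c \<subseteq> arcs \<Gamma> \<and> edge_boundary \<Gamma> c = 0}"

definition chain_scale :: "rat \<Rightarrow> ('e \<Rightarrow>\<^sub>0 rat) \<Rightarrow> ('e \<Rightarrow>\<^sub>0 rat)" where
  "chain_scale r = Poly_Mapping.map ((*) r)"

lemma lookup_chain_scale [simp]:
  "Poly_Mapping.lookup (chain_scale r c) e = r * Poly_Mapping.lookup c e"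
  by (simp add: chain_scale_def Poly_Mapping.map.rep_eq when_def)

lemma vector_space_chain_scale: "vector_space chain_scale"
  by unfold_locales (auto intro!: poly_mapping_eqI simp: lookup_add algebra_simps)

definition h1 :: "('a,'e) pre_digraph \<Rightarrow> nat" where
  "h1 \<Gamma> = vector_space.dim chain_scale (H1 \<Gamma>)"

definition component_of :: "('a,'e) pre_digraph \<Rightarrow> 'a \<Rightarrow> 'a set" where
  "component_of \<Gamma> v = {w. v \<rightarrow>\<^sup>*\<^bsub>with_proj (mk_symmetric \<Gamma>)\<^esub> w}"

definition is_tree :: "('a,'e) pre_digraph \<Rightarrow> bool" where
  "is_tree T \<longleftrightarrow> connected T \<and> h1 T = 0"

text \<open>
  A spanning tree is given by its edge set; its vertices are all vertices of the graph. For a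
  disconnected graph, it has to meet every component in a spanning tree of that component.
\<close>

definition spanning_trees :: "('a,'e) pre_digraph \<Rightarrow> 'e set set" where
  "spanning_trees \<Gamma> =
     {T. T \<subseteq> arcs \<Gamma> \<and> (\<forall>v\<in>verts \<Gamma>. is_tree (\<Gamma>\<lparr>arcs := T\<rparr> \<restriction> component_of \<Gamma> v))}"

text \<open>The subgraph with a given edge set and no isolated vertices.\<close>

definition edge_subgraph :: "('a,'e) pre_digraph \<Rightarrow> 'e set \<Rightarrow> ('a,'e) pre_digraph" where
  "edge_subgraph \<Gamma> G = \<lparr>verts = tail \<Gamma> ` G \<union> head \<Gamma> ` G, arcs = G, tail = tail \<Gamma>, head = head \<Gamma>\<rparr>"

text \<open>
  The vertices of the contracted graph are the vertex sets of the components of the graph with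
  all vertices of \<open>\<Gamma>\<close> but only the edges of \<open>G\<close>: the components of \<open>G\<close>, and singletons for the
  vertices not on \<open>G\<close>.
\<close>

definition contract :: "('a,'e) pre_digraph \<Rightarrow> 'e set \<Rightarrow> ('a set,'e) pre_digraph" where
  "contract \<Gamma> G =
     (let cl = component_of (\<Gamma>\<lparr>arcs := G\<rparr>)
      in \<lparr>verts = cl ` verts \<Gamma>, arcs = arcs \<Gamma> - G, tail = cl \<circ> tail \<Gamma>, head = cl \<circ> head \<Gamma>\<rparr>)"


section \<open>Polynomials\<close>

type_synonym ('v,'k) mpol = "('v \<Rightarrow>\<^sub>0 nat) \<Rightarrow>\<^sub>0 'k"

definition PVar :: "'v \<Rightarrow> ('v,'k::comm_ring_1) mpol" where
  "PVar v = Poly_Mapping.single (Poly_Mapping.single v 1) 1"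

definition PConst :: "'k \<Rightarrow> ('v,'k::comm_ring_1) mpol" where
  "PConst a = Poly_Mapping.single 0 a"

definition pvars :: "('v,'k::comm_ring_1) mpol \<Rightarrow> 'v set" where
  "pvars p = (\<Union>m\<in>Poly_Mapping.keys p. Poly_Mapping.keys m)"

definition psubst :: "('v \<Rightarrow> ('w,'k) mpol) \<Rightarrow> ('v,'k::comm_ring_1) mpol \<Rightarrow> ('w,'k) mpol" where
  "psubst \<theta> p = (\<Sum>m\<in>Poly_Mapping.keys p.
     PConst (Poly_Mapping.lookup p m) * (\<Prod>v\<in>Poly_Mapping.keys m. \<theta> v ^ Poly_Mapping.lookup m v))"

definition poly_ring :: "'v set \<Rightarrow> ('v,'k::comm_ring_1) mpol ring" where
  "poly_ring V = \<lparr>carrier = {p. pvars p \<subseteq> V}, mult = (*), one = 1, zero = 0, add = (+)\<rparr>"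

definition graph_poly :: "('a,'e) pre_digraph \<Rightarrow> ('e,'k::comm_ring_1) mpol" where
  "graph_poly \<Gamma> = (\<Sum>T\<in>spanning_trees \<Gamma>. \<Prod>e\<in>arcs \<Gamma> - T. PVar e)"


section \<open>Closed subschemes of products of projective spaces\<close>

text \<open>
  A list \<open>Bs = [B\<^sub>1, \<dots>, B\<^sub>r]\<close> of disjoint finite sets of variables stands for the \<open>K\<close>-scheme
  \<open>\<P>(B\<^sub>1) \<times> \<dots> \<times> \<P>(B\<^sub>r)\<close> with these homogeneous coordinates. It is covered by the affine charts
  \<open>U\<^sub>c\<close>, where \<open>c \<in> listset Bs\<close> selects one coordinate from each block; \<open>U\<^sub>c\<close> is the affine space
  with coordinate ring the polynomials in the other variables, the selected ones being set to 1.
  The ideal \<open>{0}\<close> defines the whole product. There is no chart, i.e. the scheme is empty, if some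
  block is empty.

  A multihomogeneous ideal \<open>I\<close> defines a closed subscheme \<open>V(I)\<close>, which on \<open>U\<^sub>c\<close> is given by the
  dehomogenisation of \<open>I\<close>. A closed subscheme is determined by these ideals on the charts.
\<close>

definition coords :: "'v set list \<Rightarrow> 'v set" where
  "coords Bs = \<Union>(set Bs)"

definition pideal :: "'v set list \<Rightarrow> ('v,'k::comm_ring_1) mpol set \<Rightarrow> ('v,'k) mpol set" where
  "pideal Bs S = Idl\<^bsub>poly_ring (coords Bs)\<^esub> S"

definition dehom :: "'v list \<Rightarrow> ('v,'k::comm_ring_1) mpol \<Rightarrow> ('v,'k) mpol" where
  "dehom c = psubst (\<lambda>v. if v \<in> set c then 1 else PVar v)"

definition subsch :: "'v set list \<Rightarrow> ('v,'k::comm_ring_1) mpol set \<Rightarrow> 'v list \<Rightarrow> ('v,'k) mpol set" where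
  "subsch Bs I = (\<lambda>c\<in>listset Bs. dehom c ` I)"

text \<open>\<open>V(I) \<subseteq> V(J)\<close>\<close>

definition subsch_le :: "'v set list \<Rightarrow> ('v,'k::comm_ring_1) mpol set \<Rightarrow> ('v,'k) mpol set \<Rightarrow> bool" where
  "subsch_le Bs I J \<longleftrightarrow> (\<forall>c\<in>listset Bs. subsch Bs J c \<subseteq> subsch Bs I c)"

text \<open>The ideal of the scheme-theoretic closure of \<open>V(I) - V(J)\<close>.\<close>

definition closure_of_diff ::
  "'v set list \<Rightarrow> ('v,'k::comm_ring_1) mpol set \<Rightarrow> ('v,'k) mpol set \<Rightarrow> ('v,'k) mpol set" where
  "closure_of_diff Bs I J = {p \<in> carrier (poly_ring (coords Bs)). \<forall>q\<in>J. \<exists>n. q ^ n * p \<in> I}"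

text \<open>
  The inverse images in \<open>\<P>(B) \<times> \<P>(B')\<close> of subschemes \<open>V(I)\<close> of \<open>\<P>(B)\<close> and \<open>V(J)\<close> of \<open>\<P>(B')\<close>,
  i.e. \<open>V(I) \<times> \<P>(B')\<close> and \<open>\<P>(B) \<times> V(J)\<close>.
\<close>

definition biproj :: "'v set \<Rightarrow> 'w set \<Rightarrow> ('v + 'w) set list" where
  "biproj B B' = [Inl ` B, Inr ` B']"

definition pull_fst ::
  "'v set \<Rightarrow> 'w set \<Rightarrow> ('v,'k::comm_ring_1) mpol set \<Rightarrow> ('v + 'w,'k) mpol set" where
  "pull_fst B B' I = pideal (biproj B B') (psubst (PVar \<circ> Inl) ` I)"

definition pull_snd ::
  "'v set \<Rightarrow> 'w set \<Rightarrow> ('w,'k::comm_ring_1) mpol set \<Rightarrow> ('v + 'w,'k) mpol set" where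
  "pull_snd B B' J = pideal (biproj B B') (psubst (PVar \<circ> Inr) ` J)"


subsection \<open>Morphisms given by forms\<close>

definition multihom :: "'v set list \<Rightarrow> (nat \<Rightarrow> nat) \<Rightarrow> ('v,'k::comm_ring_1) mpol \<Rightarrow> bool" where
  "multihom Bs d p \<longleftrightarrow> p \<in> carrier (poly_ring (coords Bs)) \<and>
     (\<forall>m\<in>Poly_Mapping.keys p. \<forall>i<length Bs. (\<Sum>v\<in>Bs ! i. Poly_Mapping.lookup m v) = d i)"

definition vanishes_on :: "'v set list \<Rightarrow> ('v,'k::comm_ring_1) mpol set \<Rightarrow> ('v,'k) mpol \<Rightarrow> bool" where
  "vanishes_on Bs I p \<longleftrightarrow> (\<forall>c\<in>listset Bs. dehom c p \<in> subsch Bs I c)"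

text \<open>
  \<open>\<theta>\<close> expresses the homogeneous coordinates of the target by forms in those of the source: within
  a block they have the same multidegree and no common zero on \<open>V(I)\<close>, and the equations of \<open>V(I')\<close>
  pull back to functions vanishing on \<open>V(I)\<close>.
\<close>

definition morphism_by ::
  "'v set list \<Rightarrow> ('v,'k::comm_ring_1) mpol set \<Rightarrow> 'w set list \<Rightarrow> ('w,'k) mpol set
    \<Rightarrow> ('w \<Rightarrow> ('v,'k) mpol) \<Rightarrow> bool" where
  "morphism_by Bs I Bs' I' \<theta> \<longleftrightarrow>
     (\<forall>B\<in>set Bs'. (\<exists>d. \<forall>w\<in>B. multihom Bs d (\<theta> w)) \<and> vanishes_on Bs (pideal Bs (I \<union> \<theta> ` B)) 1) \<and>
     (\<forall>p\<in>I'. vanishes_on Bs I (psubst \<theta> p))"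

text \<open>Equality of two morphisms on \<open>V(I)\<close>: in each block, the coordinate vectors are proportional.\<close>

definition same_morphism ::
  "'v set list \<Rightarrow> ('v,'k::comm_ring_1) mpol set \<Rightarrow> 'w set list
    \<Rightarrow> ('w \<Rightarrow> ('v,'k) mpol) \<Rightarrow> ('w \<Rightarrow> ('v,'k) mpol) \<Rightarrow> bool" where
  "same_morphism Bs I Bs' \<theta> \<theta>' \<longleftrightarrow>
     (\<forall>B\<in>set Bs'. \<forall>v\<in>B. \<forall>w\<in>B. vanishes_on Bs I (\<theta> v * \<theta>' w - \<theta> w * \<theta>' v))"

text \<open>\<open>\<theta>\<close> and \<open>\<eta>\<close> define mutually inverse isomorphisms between \<open>V(I)\<close> and \<open>V(I')\<close>.\<close>

definition isomorphism_by ::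
  "'v set list \<Rightarrow> ('v,'k::comm_ring_1) mpol set \<Rightarrow> 'w set list \<Rightarrow> ('w,'k) mpol set
    \<Rightarrow> ('w \<Rightarrow> ('v,'k) mpol) \<Rightarrow> ('v \<Rightarrow> ('w,'k) mpol) \<Rightarrow> bool" where
  "isomorphism_by Bs I Bs' I' \<theta> \<eta> \<longleftrightarrow>
     morphism_by Bs I Bs' I' \<theta> \<and> morphism_by Bs' I' Bs I \<eta> \<and>
     same_morphism Bs I Bs (psubst \<theta> \<circ> \<eta>) PVar \<and>
     same_morphism Bs' I' Bs' (psubst \<eta> \<circ> \<theta>) PVar"

definition inverse_image ::
  "'v set list \<Rightarrow> ('w \<Rightarrow> ('v,'k::comm_ring_1) mpol) \<Rightarrow> ('w,'k) mpol set \<Rightarrow> ('v,'k) mpol set" where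
  "inverse_image Bs \<theta> J = pideal Bs (psubst \<theta> ` J)"


subsection \<open>Blowing up\<close>

text \<open>
  Let \<open>f\<^sub>g\<close> (\<open>g \<in> G\<close>) be forms of one common degree on \<open>\<P>(B)\<close>, generating the ideal \<open>I\<close>. The blowup
  of \<open>V(I)\<close> is Proj of the Rees algebra \<open>\<Oplus>\<^sub>n I\<^sup>n t\<^sup>n\<close>. The generators \<open>f\<^sub>g t\<close> of degree one
  embed it in \<open>\<P>(B) \<times> \<P>(G)\<close>, with ideal the kernel of the map to the polynomials in \<open>B\<close> and \<open>t\<close>
  that sends the coordinate \<open>g\<close> to \<open>f\<^sub>g t\<close>. Below, \<open>t\<close> is the variable \<open>None\<close>.
\<close>

definition blowup ::
  "'v set \<Rightarrow> 'g set \<Rightarrow> ('g \<Rightarrow> ('v,'k::comm_ring_1) mpol) \<Rightarrow> ('v + 'g,'k) mpol set" where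
  "blowup B G f = {p \<in> carrier (poly_ring (coords (biproj B G))).
     psubst (case_sum (PVar \<circ> Some) (\<lambda>g. psubst (PVar \<circ> Some) (f g) * PVar None)) p
       = (0 :: ('v option,'k) mpol)}"

text \<open>Scheme-theoretic inverse image in the blowup of a subscheme of \<open>\<P>(B)\<close>.\<close>

definition total_transform ::
  "'v set \<Rightarrow> 'g set \<Rightarrow> ('g \<Rightarrow> ('v,'k::comm_ring_1) mpol) \<Rightarrow> ('v,'k) mpol set \<Rightarrow> ('v + 'g,'k) mpol set"
  where
  "total_transform B G f J = pideal (biproj B G) (blowup B G f \<union> pull_fst B G J)"

definition exceptional_locus ::
  "'v set \<Rightarrow> 'g set \<Rightarrow> ('g \<Rightarrow> ('v,'k::comm_ring_1) mpol) \<Rightarrow> ('v + 'g,'k) mpol set" where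
  "exceptional_locus B G f = total_transform B G f (pideal [B] (f ` G))"

definition strict_transform ::
  "'v set \<Rightarrow> 'g set \<Rightarrow> ('g \<Rightarrow> ('v,'k::comm_ring_1) mpol) \<Rightarrow> ('v,'k) mpol set \<Rightarrow> ('v + 'g,'k) mpol set"
  where
  "strict_transform B G f J =
     closure_of_diff (biproj B G) (total_transform B G f J) (exceptional_locus B G f)"


section \<open>The graph hypersurface and the blowup of \<open>L(G)\<close>\<close>

definition X_graph :: "('a,'e) pre_digraph \<Rightarrow> ('e,'k::comm_ring_1) mpol set" where
  "X_graph \<Gamma> = pideal [arcs \<Gamma>] {graph_poly \<Gamma>}"

definition lin_space :: "'e set \<Rightarrow> 'e set \<Rightarrow> ('e,'k::comm_ring_1) mpol set" where
  "lin_space E G = pideal [E] (PVar ` G)"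

definition exc_F :: "('a,'e) pre_digraph \<Rightarrow> 'e set \<Rightarrow> ('e + 'e,'k::comm_ring_1) mpol set" where
  "exc_F \<Gamma> G = exceptional_locus (arcs \<Gamma>) G PVar"

definition strict_Y :: "('a,'e) pre_digraph \<Rightarrow> 'e set \<Rightarrow> ('e + 'e,'k::comm_ring_1) mpol set" where
  "strict_Y \<Gamma> G = strict_transform (arcs \<Gamma>) G PVar (X_graph \<Gamma>)"

text \<open>
  Canonical maps between \<open>F\<close> and \<open>\<P>(E\<^sub>G) \<times> \<P>(E\<^bsub>\<Gamma>//G\<^esub>)\<close>. On points, with \<open>F\<close> inside
  \<open>\<P>(E\<^sub>\<Gamma>) \<times> \<P>(E\<^sub>G)\<close>, they are \<open>(A, B) \<mapsto> (B, A restricted to E\<^sub>\<Gamma> - E\<^sub>G)\<close> and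
  \<open>(B, C) \<mapsto> (C extended by 0 on E\<^sub>G, B)\<close>.
\<close>

definition F_to_prod :: "'e + 'e \<Rightarrow> ('e + 'e,'k::comm_ring_1) mpol" where
  "F_to_prod = case_sum (\<lambda>e. PVar (Inr e)) (\<lambda>e. PVar (Inl e))"

definition prod_to_F :: "'e set \<Rightarrow> 'e + 'e \<Rightarrow> ('e + 'e,'k::comm_ring_1) mpol" where
  "prod_to_F G = case_sum (\<lambda>e. if e \<in> G then 0 else PVar (Inr e)) (\<lambda>e. PVar (Inl e))"

end

theory Submission
  imports Defs "HOL-Computational_Algebra.Formal_Laurent_Series"
begin

text \<open>
  A spanning tree \<open>T\<close> of \<open>\<Gamma>\<close> is a basis of the linear matroid of the vectors \<open>head e - tail e\<close>.
  Hence \<open>T\<close> misses at least \<open>N = h\<^sub>1(G)\<close> edges of \<open>G\<close>, and those \<open>T\<close> missing exactly \<open>N\<close> are the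
  unions of a spanning tree of \<open>G\<close> and one of \<open>\<Gamma>//G\<close>. So \<open>\<Psi>\<^sub>\<Gamma>\<close> vanishes to order \<open>N\<close> along \<open>L(G)\<close>
  with leading form \<open>\<Psi>\<^sub>G \<Psi>\<^bsub>\<Gamma>//G\<^esub>\<close>. Any equation of \<open>Y\<close>, multiplied by a power of \<open>A\<^sub>g\<close>, is a multiple
  of \<open>\<Psi>\<^sub>\<Gamma>\<close> in the Rees algebra; comparing lowest order terms along \<open>F\<close>, where the leading form is
  not a zero divisor, its restriction to \<open>F\<close> is a multiple of \<open>\<Psi>\<^sub>G \<Psi>\<^bsub>\<Gamma>//G\<^esub>\<close> on the chart \<open>B\<^sub>g = 1\<close>.
  Conversely \<open>\<Psi>\<^sub>\<Gamma>\<close> divided by the \<open>N\<close>-th power of the exceptional divisor restricts to that product.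
  The product generates the ideal of the union since its factors involve disjoint sets of variables.
\<close>

section \<open>Evaluation of polynomials\<close>

text \<open>The obstacle is that no explicit equations are at hand: \<open>blowup\<close> is a
  kernel and \<open>strict_Y\<close> a saturation, with elements that need not be homogeneous. No
  generators are computed. Instead \<open>cone_eval\<close> is a ring map that kills the kernel and
  has the restriction to F as its constant coefficient, so one divisibility of power series controls
  every equation of Y at once. For the converse the single element \<open>lift_poly\<close>
  suffices. Since A_g becomes t B_g, cancelling t^n still leaves the factor B_g^n; it disappears
  only where B_g is set to 1, which is why the ideals are compared chart by chart. The matroid is
  used because contraction turns into linear algebra: \<open>\<Gamma>//G\<close> has as edge vectors
  the images in the quotient by the span of the vectors of G, and a basis of that quotient together
  with a basis of the span is a basis of the whole. This handles disconnected G and several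
  components uniformly.\<close>

locale ring_map =
  fixes h :: "'r::comm_ring_1 \<Rightarrow> 's::comm_ring_1"
  assumes one [simp]: "h 1 = 1"
    and add [simp]: "h (x + y) = h x + h y"
    and mult [simp]: "h (x * y) = h x * h y"
begin

lemma zero [simp]: "h 0 = 0"
  using add[of 0 0] by simp

lemma uminus [simp]: "h (- x) = - h x"
  using add[of x "- x"] by (simp add: eq_neg_iff_add_eq_0 add.commute)

lemma diff [simp]: "h (x - y) = h x - h y"
  using add[of x "- y"] by simp

lemma sum: "h (sum f A) = (\<Sum>x\<in>A. h (f x))"
  by (induction A rule: infinite_finite_induct) auto

lemma prod: "h (prod f A) = (\<Prod>x\<in>A. h (f x))"
  by (induction A rule: infinite_finite_induct) auto

lemma power [simp]: "h (x ^ n) = h x ^ n"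
  by (induction n) auto

end

lemma ring_map_comp: "ring_map h \<Longrightarrow> ring_map h' \<Longrightarrow> ring_map (h' \<circ> h)"
  by (simp add: ring_map_def)

definition mon_eval :: "('v \<Rightarrow> 'r::comm_ring_1) \<Rightarrow> ('v \<Rightarrow>\<^sub>0 nat) \<Rightarrow> 'r" where
  "mon_eval \<theta> m = (\<Prod>v\<in>Poly_Mapping.keys m. \<theta> v ^ Poly_Mapping.lookup m v)"

text \<open>The coefficient map is a parameter because one notion has to cover
  \<open>psubst\<close>, maps into power and Laurent series, and the passage to polynomials whose
  coefficients are polynomials.\<close>

definition peval :: "('k \<Rightarrow> 'r) \<Rightarrow> ('v \<Rightarrow> 'r) \<Rightarrow> ('v,'k::comm_ring_1) mpol \<Rightarrow> 'r::comm_ring_1" where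
  "peval \<kappa> \<theta> p = (\<Sum>m\<in>Poly_Mapping.keys p. \<kappa> (Poly_Mapping.lookup p m) * mon_eval \<theta> m)"

lemma psubst_eq_peval: "psubst = peval PConst"
  by (intro ext) (simp add: psubst_def peval_def mon_eval_def)

text \<open>Kept general in index and values, so that the same rule serves polynomials, their
  exponents and rational chains.\<close>

lemma mpol_induct [case_names zero single add]:
  fixes p :: "'a \<Rightarrow>\<^sub>0 'b::comm_monoid_add"
  assumes "P 0" "\<And>m a. P (Poly_Mapping.single m a)" "\<And>p q. P p \<Longrightarrow> P q \<Longrightarrow> P (p + q)"
  shows "P p"
proof -
  have "P (\<Sum>m\<in>A. Poly_Mapping.single m (Poly_Mapping.lookup p m))" if "finite A" for A
    using that by (induction A rule: finite_induct) (auto intro: assms)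
  moreover have "p = (\<Sum>m\<in>Poly_Mapping.keys p. Poly_Mapping.single m (Poly_Mapping.lookup p m))"
  proof (rule poly_mapping_eqI)
    fix k
    show "Poly_Mapping.lookup p k
      = Poly_Mapping.lookup (\<Sum>m\<in>Poly_Mapping.keys p. Poly_Mapping.single m (Poly_Mapping.lookup p m)) k"
      by (simp add: lookup_sum lookup_single when_def in_keys_iff)
  qed
  ultimately show ?thesis by (metis finite_keys)
qed

lemma mon_eval_superset:
  assumes "finite A" "Poly_Mapping.keys m \<subseteq> A"
  shows "mon_eval \<theta> m = (\<Prod>v\<in>A. \<theta> v ^ Poly_Mapping.lookup m v)"
  unfolding mon_eval_def using assms
  by (intro prod.mono_neutral_left) (auto simp: in_keys_iff)

lemma mon_eval_0 [simp]: "mon_eval \<theta> 0 = 1"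
  by (simp add: mon_eval_def)

lemma mon_eval_single [simp]: "mon_eval \<theta> (Poly_Mapping.single v n) = \<theta> v ^ n"
  by (simp add: mon_eval_def)

lemma mon_eval_add: "mon_eval \<theta> (m + n) = mon_eval \<theta> m * mon_eval \<theta> n"
proof -
  let ?A = "Poly_Mapping.keys m \<union> Poly_Mapping.keys n"
  have "Poly_Mapping.keys (m + n) \<subseteq> ?A" by (rule Poly_Mapping.keys_add)
  then show ?thesis
    by (simp add: mon_eval_superset[of ?A] lookup_add power_add prod.distrib)
qed

locale eval_map = ring_map \<kappa> for \<kappa> :: "'k::comm_ring_1 \<Rightarrow> 'r::comm_ring_1"
begin

lemma peval_superset:
  assumes "finite A" "Poly_Mapping.keys p \<subseteq> A"
  shows "peval \<kappa> \<theta> p = (\<Sum>m\<in>A. \<kappa> (Poly_Mapping.lookup p m) * mon_eval \<theta> m)"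
  unfolding peval_def using assms
  by (intro sum.mono_neutral_left) (auto simp: in_keys_iff)

lemma peval_single [simp]: "peval \<kappa> \<theta> (Poly_Mapping.single m a) = \<kappa> a * mon_eval \<theta> m"
  by (simp add: peval_superset[of "{m}"])

lemma peval_0 [simp]: "peval \<kappa> \<theta> 0 = 0"
  by (simp add: peval_def)

lemma peval_add [simp]: "peval \<kappa> \<theta> (p + q) = peval \<kappa> \<theta> p + peval \<kappa> \<theta> q"
proof -
  let ?A = "Poly_Mapping.keys p \<union> Poly_Mapping.keys q"
  have "Poly_Mapping.keys (p + q) \<subseteq> ?A" by (rule Poly_Mapping.keys_add)
  then show ?thesis
    by (simp add: peval_superset[of ?A] lookup_add sum.distrib algebra_simps)
qed

lemma peval_mult [simp]: "peval \<kappa> \<theta> (p * q) = peval \<kappa> \<theta> p * peval \<kappa> \<theta> q"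
proof (induction p rule: mpol_induct)
  case (single m a)
  show ?case
  proof (induction q rule: mpol_induct)
    case (single n b)
    show ?case by (simp add: mult_single mon_eval_add mult_ac)
  qed (simp_all add: distrib_left)
qed (simp_all add: distrib_right)

lemma peval_1 [simp]: "peval \<kappa> \<theta> 1 = 1"
  using peval_single[of \<theta> 0 1] by simp

sublocale pe: ring_map "peval \<kappa> \<theta>" for \<theta>
  by unfold_locales auto

lemma peval_PVar [simp]: "peval \<kappa> \<theta> (PVar v) = \<theta> v"
  by (simp add: PVar_def)

lemma peval_PConst [simp]: "peval \<kappa> \<theta> (PConst a) = \<kappa> a"
  by (simp add: PConst_def)

end

lemma peval_cong:
  assumes "\<And>v. v \<in> pvars p \<Longrightarrow> \<theta> v = \<eta> v"
  shows "peval \<kappa> \<theta> p = peval \<kappa> \<eta> p"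
  unfolding peval_def mon_eval_def
  by (intro sum.cong refl arg_cong2[of _ _ _ _ "(*)"] prod.cong arg_cong2[of _ _ _ _ "(^)"] assms)
     (auto simp: pvars_def)

lemma mon_eval_hom: "ring_map h \<Longrightarrow> h (mon_eval \<theta> m) = mon_eval (h \<circ> \<theta>) m"
  by (simp add: mon_eval_def ring_map.prod ring_map.power)

lemma peval_hom: "ring_map h \<Longrightarrow> h (peval \<kappa> \<theta> p) = peval (h \<circ> \<kappa>) (h \<circ> \<theta>) p"
  by (simp add: peval_def ring_map.sum ring_map.mult mon_eval_hom)

interpretation PConst: eval_map PConst
  by unfold_locales (auto simp: PConst_def mult_single single_add)

lemma mon_eval_PVar: "mon_eval PVar m = (Poly_Mapping.single m 1 :: ('v,'k::comm_ring_1) mpol)"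
proof (induction m rule: mpol_induct)
  case (single v n)
  show ?case
    by (induction n) (auto simp: PVar_def mult_single single_add[symmetric])
qed (simp_all add: mon_eval_add mult_single)

lemma PConst_mult_single: "PConst a * Poly_Mapping.single m b = Poly_Mapping.single m (a * b)"
  by (simp add: PConst_def mult_single)

lemma peval_PVar_id [simp]: "peval PConst PVar p = p"
  by (induction p rule: mpol_induct) (auto simp: mon_eval_PVar PConst_mult_single)

lemma ring_map_psubst: "ring_map (psubst \<theta>)"
  unfolding psubst_eq_peval by unfold_locales auto

interpretation psubst: ring_map "psubst \<theta>" for \<theta>
  by (rule ring_map_psubst)

lemma psubst_PVar [simp]: "psubst \<theta> (PVar v) = \<theta> v"
  by (simp add: psubst_eq_peval)

lemma psubst_PConst [simp]: "psubst \<theta> (PConst a) = PConst a"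
  by (simp add: psubst_eq_peval)

lemma psubst_PVar_id: "(\<And>v. v \<in> pvars p \<Longrightarrow> \<theta> v = PVar v) \<Longrightarrow> psubst \<theta> p = p"
  using peval_cong[of p \<theta> PVar PConst] by (simp add: psubst_eq_peval)

lemma peval_psubst:
  assumes "ring_map \<kappa>"
  shows "peval \<kappa> \<theta> (psubst \<eta> p) = peval \<kappa> (peval \<kappa> \<theta> \<circ> \<eta>) p"
proof -
  interpret eval_map \<kappa> using assms by (simp add: eval_map_def)
  show ?thesis
    using peval_hom[OF pe.ring_map_axioms, of \<theta> PConst \<eta> p] by (simp add: psubst_eq_peval comp_def)
qed

lemma psubst_psubst: "psubst \<theta> (psubst \<eta> p) = psubst (psubst \<theta> \<circ> \<eta>) p"
  using peval_psubst[OF PConst.ring_map_axioms, of \<theta> \<eta> p] by (simp only: psubst_eq_peval)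

section \<open>Variables that occur in a polynomial\<close>

lemma pvars_0 [simp]: "pvars 0 = {}"
  by (simp add: pvars_def)

lemma pvars_1 [simp]: "pvars 1 = {}"
  by (simp add: pvars_def)

lemma pvars_PVar [simp]: "pvars (PVar v) = {v}"
  by (simp add: pvars_def PVar_def)

lemma pvars_PConst [simp]: "pvars (PConst a) = {}"
  by (simp add: pvars_def PConst_def)

lemma pvars_uminus [simp]: "pvars (- p) = pvars p"
  by (simp add: pvars_def keys_def)

lemma pvars_add: "pvars (p + q) \<subseteq> pvars p \<union> pvars q"
  using Poly_Mapping.keys_add[of p q] by (auto simp: pvars_def)

lemma pvars_mult: "pvars (p * q) \<subseteq> pvars p \<union> pvars q"
proof
  fix v assume "v \<in> pvars (p * q)"
  then obtain m where m: "m \<in> Poly_Mapping.keys (p * q)" "v \<in> Poly_Mapping.keys m"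
    by (auto simp: pvars_def)
  then obtain a b where "m = a + b" "a \<in> Poly_Mapping.keys p" "b \<in> Poly_Mapping.keys q"
    using keys_mult[of p q] by auto
  with m(2) Poly_Mapping.keys_add[of a b] show "v \<in> pvars p \<union> pvars q"
    by (auto simp: pvars_def)
qed

lemma pvars_power: "pvars (p ^ n) \<subseteq> pvars p"
  by (induction n) (auto dest!: subsetD[OF pvars_mult])

lemma pvars_sum: "pvars (sum f A) \<subseteq> (\<Union>x\<in>A. pvars (f x))"
  by (induction A rule: infinite_finite_induct) (auto dest!: subsetD[OF pvars_add])

lemma pvars_prod: "pvars (prod f A) \<subseteq> (\<Union>x\<in>A. pvars (f x))"
  by (induction A rule: infinite_finite_induct) (auto dest!: subsetD[OF pvars_mult])

lemma pvars_psubst: "pvars (psubst \<theta> p) \<subseteq> (\<Union>v\<in>pvars p. pvars (\<theta> v))"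
proof
  fix w assume "w \<in> pvars (psubst \<theta> p)"
  then obtain m where m: "m \<in> Poly_Mapping.keys p" and
    "w \<in> pvars (PConst (Poly_Mapping.lookup p m) *
        (\<Prod>v\<in>Poly_Mapping.keys m. \<theta> v ^ Poly_Mapping.lookup m v))"
    using pvars_sum unfolding psubst_def by fast
  then have "w \<in> pvars (\<Prod>v\<in>Poly_Mapping.keys m. \<theta> v ^ Poly_Mapping.lookup m v)"
    by (auto dest!: subsetD[OF pvars_mult])
  then obtain v where "v \<in> Poly_Mapping.keys m" "w \<in> pvars (\<theta> v ^ Poly_Mapping.lookup m v)"
    by (auto dest!: subsetD[OF pvars_prod])
  with m show "w \<in> (\<Union>v\<in>pvars p. pvars (\<theta> v))"
    by (auto simp: pvars_def[of p] dest!: subsetD[OF pvars_power])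
qed

lemma pvars_mult_subset: "pvars p \<subseteq> V \<Longrightarrow> pvars q \<subseteq> V \<Longrightarrow> pvars (p * q) \<subseteq> V"
  by (rule order.trans[OF pvars_mult]) simp

lemma pvars_add_subset: "pvars p \<subseteq> V \<Longrightarrow> pvars q \<subseteq> V \<Longrightarrow> pvars (p + q) \<subseteq> V"
  by (rule order.trans[OF pvars_add]) simp

lemma pvars_power_subset: "pvars p \<subseteq> V \<Longrightarrow> pvars (p ^ n) \<subseteq> V"
  by (rule order.trans[OF pvars_power])

lemma finite_pvars [simp]: "finite (pvars p)"
  by (simp add: pvars_def)

text \<open>Leading terms need an order on the variables, and \<open>'v\<close> has none. Only
  finitely many variables occur, so they are renamed injectively into \<open>nat\<close> and
  back.\<close>

lemma mpol_no_zero_divisors: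
  fixes p q :: "('v,'k::idom) mpol"
  assumes "p * q = 0" shows "p = 0 \<or> q = 0"
proof -
  obtain \<iota> :: "'v \<Rightarrow> nat" where \<iota>: "inj_on \<iota> (pvars p \<union> pvars q)"
    using finite_imp_inj_to_nat_seg[of "pvars p \<union> pvars q"] by auto
  define j where "j = inv_into (pvars p \<union> pvars q) \<iota>"
  have id: "psubst (PVar \<circ> j) (psubst (PVar \<circ> \<iota>) r) = r" if "pvars r \<subseteq> pvars p \<union> pvars q" for r :: "('v,'k) mpol"
    unfolding psubst_psubst using that \<iota> by (intro psubst_PVar_id) (auto simp: j_def)
  have "psubst (PVar \<circ> \<iota>) p * psubst (PVar \<circ> \<iota>) q = 0"
    using assms by (metis psubst.mult psubst.zero)
  then show ?thesis using id[of p] id[of q] by (auto simp: mult_eq_0_iff)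
qed

section \<open>Ideals of polynomials in prescribed variables\<close>

lemma cring_poly_ring: "cring (poly_ring V)"
proof (rule cringI)
  show "abelian_group (poly_ring V)"
  proof (rule abelian_groupI)
    fix x assume "x \<in> carrier (poly_ring V)"
    then show "\<exists>y\<in>carrier (poly_ring V). y \<oplus>\<^bsub>poly_ring V\<^esub> x = \<zero>\<^bsub>poly_ring V\<^esub>"
      by (intro bexI[of _ "- x"]) (auto simp: poly_ring_def)
  qed (use pvars_add in \<open>fastforce simp: poly_ring_def algebra_simps\<close>)+
  show "Group.comm_monoid (poly_ring V)"
    by unfold_locales (use pvars_mult in \<open>fastforce simp: poly_ring_def algebra_simps\<close>)+
qed (simp add: poly_ring_def algebra_simps)

lemma ideal_poly_ring:
  assumes "I \<subseteq> {p. pvars p \<subseteq> V}" "0 \<in> I" "\<And>x y. x \<in> I \<Longrightarrow> y \<in> I \<Longrightarrow> x + y \<in> I"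
    and mult: "\<And>a x. pvars a \<subseteq> V \<Longrightarrow> x \<in> I \<Longrightarrow> a * x \<in> I"
  shows "ideal I (poly_ring V :: ('v,'k::comm_ring_1) mpol ring)"
proof (rule idealI)
  interpret R: cring "poly_ring V :: ('v,'k) mpol ring" by (rule cring_poly_ring)
  show "Ring.ring (poly_ring V :: ('v,'k) mpol ring)" by unfold_locales
  show "subgroup I (add_monoid (poly_ring V))"
  proof (rule group.subgroupI)
    show "group (add_monoid (poly_ring V :: ('v,'k) mpol ring))"
      by (rule R.a_group)
    fix x assume x: "x \<in> I"
    then have "\<ominus>\<^bsub>poly_ring V\<^esub> x = - x"
      using assms(1) by (intro R.minus_equality) (auto simp: poly_ring_def)
    moreover have "- x \<in> I" using mult[of "- 1" x] x by simp
    ultimately show "inv\<^bsub>add_monoid (poly_ring V)\<^esub> x \<in> I" by (simp add: a_inv_def)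
  qed (use assms in \<open>auto simp: poly_ring_def\<close>)
qed (auto simp: poly_ring_def intro: mult, metis mult mult.commute)

text \<open>Minimality of the generated ideal as an induction rule: the polynomials satisfying
  \<open>P\<close> form an ideal that contains \<open>S\<close>. It replaces explicit linear
  combinations of generators.\<close>

lemma pideal_induct [consumes 2, case_names base zero add mult]:
  assumes "x \<in> pideal Bs S" "S \<subseteq> {p. pvars p \<subseteq> coords Bs}"
    and "\<And>x. x \<in> S \<Longrightarrow> P x" "P 0"
    and "\<And>x y. P x \<Longrightarrow> P y \<Longrightarrow> P (x + y)"
    and "\<And>a x. pvars a \<subseteq> coords Bs \<Longrightarrow> P x \<Longrightarrow> P (a * x)"
  shows "P (x :: ('v,'k::comm_ring_1) mpol)"
proof -
  interpret R: cring "poly_ring (coords Bs) :: ('v,'k) mpol ring" by (rule cring_poly_ring)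
  let ?I = "{p. pvars p \<subseteq> coords Bs \<and> P p}"
  have "ideal ?I (poly_ring (coords Bs))"
  proof (rule ideal_poly_ring)
    show "a * x \<in> ?I" if "pvars a \<subseteq> coords Bs" "x \<in> ?I" for a x
      using that pvars_mult[of a x] assms(6)[of a x] by auto
    show "x + y \<in> ?I" if "x \<in> ?I" "y \<in> ?I" for x y
      using that pvars_add[of x y] assms(5)[of x y] by auto
  qed (use assms in auto)
  then have "pideal Bs S \<subseteq> ?I"
    unfolding pideal_def using assms by (intro R.genideal_minimal) auto
  then show ?thesis using assms(1) by auto
qed

context
  fixes Bs :: "'v set list" and S :: "('v,'k::comm_ring_1) mpol set"
  assumes S: "S \<subseteq> {p. pvars p \<subseteq> coords Bs}"
begin

lemma pideal_ideal: "ideal (pideal Bs S) (poly_ring (coords Bs))"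
  using cring.axioms(1)[OF cring_poly_ring] S unfolding pideal_def
  by (intro ring.genideal_ideal) (auto simp: poly_ring_def)

lemma pideal_base: "x \<in> S \<Longrightarrow> x \<in> pideal Bs S"
  using ring.genideal_self[OF cring.axioms(1)[OF cring_poly_ring], of S "coords Bs"] S
  unfolding pideal_def by (auto simp: poly_ring_def)

lemma pideal_pvars: "x \<in> pideal Bs S \<Longrightarrow> pvars x \<subseteq> coords Bs"
  using ideal.Icarr[OF pideal_ideal] by (auto simp: poly_ring_def)

lemma pideal_subset: "pideal Bs S \<subseteq> {p. pvars p \<subseteq> coords Bs}"
  using pideal_pvars by auto

lemma pideal_0: "0 \<in> pideal Bs S"
  using additive_subgroup.zero_closed[OF ideal.axioms(1)[OF pideal_ideal]]
  by (simp add: poly_ring_def)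

lemma pideal_add: "x \<in> pideal Bs S \<Longrightarrow> y \<in> pideal Bs S \<Longrightarrow> x + y \<in> pideal Bs S"
  using additive_subgroup.a_closed[OF ideal.axioms(1)[OF pideal_ideal]]
  by (simp add: poly_ring_def)

lemma pideal_mult: "x \<in> pideal Bs S \<Longrightarrow> pvars a \<subseteq> coords Bs \<Longrightarrow> a * x \<in> pideal Bs S"
  using ideal.I_l_closed[OF pideal_ideal] by (simp add: poly_ring_def)

lemma pideal_sum: "(\<And>i. i \<in> A \<Longrightarrow> f i \<in> pideal Bs S) \<Longrightarrow> sum f A \<in> pideal Bs S"
  by (induction A rule: infinite_finite_induct) (auto intro: pideal_0 pideal_add)

end

lemma mem_carrier_poly_ring [simp]: "p \<in> carrier (poly_ring V) \<longleftrightarrow> pvars p \<subseteq> V"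
  by (simp add: poly_ring_def)

section \<open>Cancelling a factor in other variables\<close>

lemma lookup_PConst_mult: "Poly_Mapping.lookup (PConst f * p) m = f * Poly_Mapping.lookup p m"
  unfolding PConst_def mult_map_scale_conv_mult[symmetric]
  by (simp add: Poly_Mapping.map.rep_eq when_def)

lemma PConst_dvd_iff: "PConst f dvd p \<longleftrightarrow> (\<forall>m. f dvd Poly_Mapping.lookup p m)"
proof
  assume R: "\<forall>m. f dvd Poly_Mapping.lookup p m"
  define q where "q m = (SOME c. Poly_Mapping.lookup p m = f * c)" for m
  have q: "Poly_Mapping.lookup p m = f * q m" for m
    unfolding q_def using someI_ex[of "\<lambda>c. Poly_Mapping.lookup p m = f * c"] R by (auto simp: dvd_def)
  have "p = PConst f * (\<Sum>m\<in>Poly_Mapping.keys p. Poly_Mapping.single m (q m))"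
    by (rule poly_mapping_eqI)
       (auto simp: lookup_PConst_mult lookup_sum lookup_single when_def q[symmetric] in_keys_iff)
  then show "PConst f dvd p" by (rule dvdI)
qed (auto simp: lookup_PConst_mult)

text \<open>Addition of exponents is strictly monotone, so among pairs from the two supports only
  \<open>(m0, m1)\<close> can have this sum. The bounds need not be attained, and the coefficients
  may have zero divisors.\<close>

lemma lookup_mult_top:
  fixes g b :: "'m::{ordered_cancel_comm_monoid_add,linorder} \<Rightarrow>\<^sub>0 'r::comm_ring_1"
  assumes "\<And>m. m \<in> Poly_Mapping.keys g \<Longrightarrow> m \<le> m0" "\<And>m. m \<in> Poly_Mapping.keys b \<Longrightarrow> m \<le> m1"
  shows "Poly_Mapping.lookup (g * b) (m0 + m1) = Poly_Mapping.lookup g m0 * Poly_Mapping.lookup b m1"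
proof -
  have "u + v = m0 + m1 \<longleftrightarrow> u = m0 \<and> v = m1"
    if "u \<in> Poly_Mapping.keys g" "v \<in> Poly_Mapping.keys b" for u v
    using add_mono[of u m0 v m1] add_less_le_mono[of u m0 v m1] add_le_less_mono[of u m0 v m1]
      assms that by force
  note eq = this
  have expand: "p = (\<Sum>m\<in>Poly_Mapping.keys p. Poly_Mapping.single m (Poly_Mapping.lookup p m))"
    for p :: "'m \<Rightarrow>\<^sub>0 'r"
    by (rule poly_mapping_eqI) (simp add: lookup_sum lookup_single when_def in_keys_iff)
  have "g * b = (\<Sum>u\<in>Poly_Mapping.keys g. \<Sum>v\<in>Poly_Mapping.keys b.
      Poly_Mapping.single (u + v) (Poly_Mapping.lookup g u * Poly_Mapping.lookup b v))"
    unfolding arg_cong2[OF expand[of g] expand[of b], of "(*)"] by (simp add: sum_product mult_single)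
  then have "Poly_Mapping.lookup (g * b) (m0 + m1) =
     (\<Sum>u\<in>Poly_Mapping.keys g. \<Sum>v\<in>Poly_Mapping.keys b.
       if u = m0 \<and> v = m1 then Poly_Mapping.lookup g u * Poly_Mapping.lookup b v else 0)"
    by (auto simp: lookup_sum lookup_single when_def eq intro!: sum.cong)
  also have "\<dots> = (\<Sum>u\<in>Poly_Mapping.keys g. if u = m0 then
      (\<Sum>v\<in>Poly_Mapping.keys b. if v = m1 then Poly_Mapping.lookup g u * Poly_Mapping.lookup b v else 0) else 0)"
    by (intro sum.cong) auto
  also have "\<dots> = Poly_Mapping.lookup g m0 * Poly_Mapping.lookup b m1"
    by (auto simp: in_keys_iff)
  finally show ?thesis .
qed

text \<open>A leading coefficient that is a unit makes \<open>g\<close> a non-zero-divisor also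
  modulo \<open>f\<close>: the top coefficient of \<open>b\<close> not divisible by \<open>f\<close>
  would survive, up to a unit, in the product.\<close>

lemma PConst_dvd_mult_cancel:
  fixes g b :: "(nat,'r::comm_ring_1) mpol"
  assumes "PConst f dvd g * b"
    and lead: "Poly_Mapping.lookup g m0 dvd 1" "\<And>m. m \<in> Poly_Mapping.keys g \<Longrightarrow> m \<le> m0"
  shows "PConst f dvd b"
proof (rule ccontr)
  assume "\<not> PConst f dvd b"
  define B where "B = {m\<in>Poly_Mapping.keys b. \<not> f dvd Poly_Mapping.lookup b m}"
  have "finite B" by (simp add: B_def)
  obtain m where m: "\<not> f dvd Poly_Mapping.lookup b m"
    using \<open>\<not> PConst f dvd b\<close> by (auto simp: PConst_dvd_iff)
  then have "Poly_Mapping.lookup b m \<noteq> 0" by (metis dvd_0_right)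
  with m have "B \<noteq> {}" by (auto simp: B_def in_keys_iff)
  define m1 where "m1 = Max B"
  have m1: "m1 \<in> B" "\<And>m. m \<in> B \<Longrightarrow> m \<le> m1"
    using \<open>finite B\<close> \<open>B \<noteq> {}\<close> by (auto simp: m1_def)
  \<comment> \<open>\<open>c\<close> is \<open>b\<close> stripped of its coefficients divisible by
    \<open>f\<close>. Modulo \<open>f\<close> nothing changes, and \<open>m1\<close> becomes the top
    exponent.\<close>
  define c where "c = (\<Sum>m\<in>B. Poly_Mapping.single m (Poly_Mapping.lookup b m))"
  have c: "Poly_Mapping.lookup c m = (if m \<in> B then Poly_Mapping.lookup b m else 0)" for m
    using \<open>finite B\<close> by (simp add: c_def lookup_sum lookup_single when_def)
  have "PConst f dvd b - c"
    by (auto simp: PConst_dvd_iff lookup_minus c B_def in_keys_iff)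
  then have "PConst f dvd g * b - g * (b - c)"
    using assms(1) by (metis dvd_diff dvd_mult)
  then have "PConst f dvd g * c" by (simp add: algebra_simps)
  then have "f dvd Poly_Mapping.lookup (g * c) (m0 + m1)" by (simp add: PConst_dvd_iff)
  also have "\<dots> = Poly_Mapping.lookup g m0 * Poly_Mapping.lookup b m1"
    using lead(2) m1 by (subst lookup_mult_top) (auto simp: c in_keys_iff split: if_splits)
  finally have *: "f dvd Poly_Mapping.lookup g m0 * Poly_Mapping.lookup b m1" .
  from lead(1) obtain u where "1 = Poly_Mapping.lookup g m0 * u" by (rule dvdE)
  then have "Poly_Mapping.lookup b m1 = u * (Poly_Mapping.lookup g m0 * Poly_Mapping.lookup b m1)"
    by (metis mult.assoc mult.commute mult.left_neutral)
  then have "f dvd Poly_Mapping.lookup b m1" using * by (metis dvd_mult)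
  then show False using m1(1) by (simp add: B_def)
qed

lemma lookup_peval_PConst:
  "Poly_Mapping.lookup (peval (PConst \<circ> h) PVar p) m = h (Poly_Mapping.lookup p m)"
  if "ring_map h" for h :: "'k::comm_ring_1 \<Rightarrow> 'r::comm_ring_1" and p :: "('v,'k) mpol"
proof -
  define \<kappa> where "\<kappa> = (PConst :: 'r \<Rightarrow> ('v,'r) mpol) \<circ> h"
  interpret h: ring_map h by (rule that)
  interpret \<kappa>: eval_map \<kappa>
    unfolding eval_map_def \<kappa>_def by (rule ring_map_comp[OF that PConst.ring_map_axioms])
  have "Poly_Mapping.lookup (peval \<kappa> PVar p) m = h (Poly_Mapping.lookup p m)"
  proof (induction p rule: mpol_induct)
    case (single n a)
    have "\<kappa> a = PConst (h a)" by (simp add: \<kappa>_def)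
    then show ?case
      by (simp add: lookup_single when_def mon_eval_PVar PConst_mult_single)
  qed (simp_all add: lookup_add)
  then show ?thesis by (simp only: \<kappa>_def)
qed

lemma PConst_dvd_1: "c \<noteq> 0 \<Longrightarrow> PConst (c :: 'k::field) dvd 1"
  by (rule dvdI[of _ _ "PConst (1 / c)"]) (simp flip: PConst.mult)

text \<open>Read polynomials in both sets of variables as polynomials in the second set with
  coefficients in the first. Then \<open>f\<close> is a constant, while \<open>f'\<close> has
  coefficients in the field, so its leading coefficient is a unit and
  \<open>PConst_dvd_mult_cancel\<close> applies. No unique factorization enters.\<close>

lemma dvd_disjoint_cancel:
  fixes f :: "('v,'k::field) mpol" and f' :: "('w,'k) mpol"
  assumes dvd: "psubst (PVar \<circ> Inl) f dvd psubst (PVar \<circ> Inr) f' * b" and "f' \<noteq> 0"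
  shows "psubst (PVar \<circ> Inl) f dvd b"
proof -
  \<comment> \<open>The second set of variables is renamed into \<open>nat\<close> to obtain an
    ordering; the renaming must be invertible on \<open>b\<close> too, since \<open>b\<close> has to
    be recovered by \<open>\<Omega>'\<close>.\<close>
  define V where "V = pvars f' \<union> {w. Inr w \<in> pvars b}"
  have "finite V" unfolding V_def
    using finite_vimageI[of "pvars b" Inr] by (simp add: vimage_def)
  then obtain \<iota> :: "'w \<Rightarrow> nat" where \<iota>: "inj_on \<iota> V"
    using finite_imp_inj_to_nat_seg[OF \<open>finite V\<close>] by metis
  define j where "j = inv_into V \<iota>"
  have j: "j (\<iota> w) = w" if "w \<in> V" for w using that \<iota> by (simp add: j_def)
  define \<kappa> :: "'k \<Rightarrow> (nat,('v,'k) mpol) mpol" where "\<kappa> = PConst \<circ> PConst"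
  define \<Omega> where "\<Omega> = peval \<kappa> (case_sum (PConst \<circ> PVar) (PVar \<circ> \<iota>))"
  define \<Omega>' :: "(nat,('v,'k) mpol) mpol \<Rightarrow> ('v + 'w,'k) mpol"
    where "\<Omega>' = peval (psubst (PVar \<circ> Inl)) (PVar \<circ> Inr \<circ> j)"
  have \<kappa>: "ring_map \<kappa>"
    unfolding \<kappa>_def by (rule ring_map_comp) (rule PConst.ring_map_axioms)+
  interpret \<Omega>: eval_map \<kappa> using \<kappa> by (simp add: eval_map_def)
  interpret \<Omega>': eval_map "psubst (PVar \<circ> Inl) :: ('v,'k) mpol \<Rightarrow> ('v + 'w,'k) mpol"
    by (simp add: eval_map_def ring_map_psubst)
  have \<Omega>f: "\<Omega> (psubst (PVar \<circ> Inl) f) = PConst f"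
  proof -
    have "\<Omega> (psubst (PVar \<circ> Inl) f) = peval \<kappa> (PConst \<circ> PVar) f"
      unfolding \<Omega>_def peval_psubst[OF \<kappa>] by (simp add: comp_def)
    then show ?thesis
      using peval_hom[OF PConst.ring_map_axioms, of PConst PVar f] by (metis \<kappa>_def peval_PVar_id)
  qed
  define g where "g = psubst (PVar \<circ> \<iota>) f'"
  have "psubst (PVar \<circ> j) g = f'"
    unfolding g_def psubst_psubst by (rule psubst_PVar_id) (simp add: j V_def)
  then have "g \<noteq> 0" using \<open>f' \<noteq> 0\<close> by auto
  have \<Omega>f': "\<Omega> (psubst (PVar \<circ> Inr) f') = peval \<kappa> PVar g"
    unfolding \<Omega>_def g_def peval_psubst[OF \<kappa>] by (simp add: comp_def)
  define m0 where "m0 = Max (Poly_Mapping.keys g)"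
  have "Poly_Mapping.keys g \<noteq> {}"
    using \<open>g \<noteq> 0\<close> by (auto intro: poly_mapping_eqI simp: in_keys_iff)
  then have m0: "m0 \<in> Poly_Mapping.keys g" "\<And>m. m \<in> Poly_Mapping.keys g \<Longrightarrow> m \<le> m0"
    by (auto simp: m0_def)
  \<comment> \<open>The coefficients of \<open>f'\<close> remain field constants, hence the nonzero
    leading one is invertible.\<close>
  have lg: "Poly_Mapping.lookup (peval \<kappa> PVar g) m = PConst (Poly_Mapping.lookup g m)" for m
    unfolding \<kappa>_def by (rule lookup_peval_PConst) (rule PConst.ring_map_axioms)
  have "PConst f dvd peval \<kappa> PVar g * \<Omega> b"
    using dvd unfolding \<Omega>f[symmetric] \<Omega>f'[symmetric]
    by (metis \<Omega>.pe.mult \<Omega>_def dvd_def)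
  moreover have "Poly_Mapping.lookup (peval \<kappa> PVar g) m0 dvd 1"
    using m0(1) by (auto simp: lg in_keys_iff intro: PConst_dvd_1)
  moreover have "m \<le> m0" if "m \<in> Poly_Mapping.keys (peval \<kappa> PVar g)" for m
    using that m0(2) by (metis PConst.zero in_keys_iff lg)
  ultimately have "PConst f dvd \<Omega> b"
    by (rule PConst_dvd_mult_cancel)
  then obtain a where "\<Omega> b = PConst f * a" by (rule dvdE)
  then have "\<Omega>' (\<Omega> b) = psubst (PVar \<circ> Inl) f * \<Omega>' a" by (simp add: \<Omega>'_def)
  moreover have "\<Omega>' (\<Omega> b) = peval PConst (\<Omega>' \<circ> case_sum (PConst \<circ> PVar) (PVar \<circ> \<iota>)) b"
    unfolding \<Omega>_def \<Omega>'_def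
    by (subst peval_hom[OF \<Omega>'.pe.ring_map_axioms])
       (rule arg_cong2[of _ _ _ _ "\<lambda>x y. peval x y b"]; simp add: fun_eq_iff \<kappa>_def)
  moreover have "\<dots> = b"
    unfolding psubst_eq_peval[symmetric]
    by (rule psubst_PVar_id) (auto simp: \<Omega>'_def V_def j split: sum.split)
  ultimately show ?thesis by (metis dvd_triv_left)
qed

section \<open>Spanning trees as bases of a linear matroid\<close>

interpretation chain: vector_space chain_scale
  by (rule vector_space_chain_scale)

text \<open>Boundary maps, restrictions, quotient maps and functionals are all obtained as linear
  extensions from unit chains, so that \<open>lext_lext\<close> computes every composite.\<close>

definition lext :: "('b \<Rightarrow> ('c \<Rightarrow>\<^sub>0 rat)) \<Rightarrow> ('b \<Rightarrow>\<^sub>0 rat) \<Rightarrow> ('c \<Rightarrow>\<^sub>0 rat)" where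
  "lext f c = (\<Sum>e\<in>Poly_Mapping.keys c. chain_scale (Poly_Mapping.lookup c e) (f e))"

abbreviation pt :: "'b \<Rightarrow> ('b \<Rightarrow>\<^sub>0 rat)" where
  "pt v \<equiv> Poly_Mapping.single v 1"

lemma chain_scale_single: "chain_scale r (Poly_Mapping.single v a) = Poly_Mapping.single v (r * a)"
  by (rule poly_mapping_eqI) (simp add: lookup_single when_def)

lemma lext_superset:
  assumes "finite A" "Poly_Mapping.keys c \<subseteq> A"
  shows "lext f c = (\<Sum>e\<in>A. chain_scale (Poly_Mapping.lookup c e) (f e))"
  unfolding lext_def using assms by (intro sum.mono_neutral_left) (auto simp: in_keys_iff)

lemma lext_0 [simp]: "lext f 0 = 0"
  by (simp add: lext_def)

lemma lext_single [simp]: "lext f (Poly_Mapping.single e a) = chain_scale a (f e)"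
  by (simp add: lext_superset[of "{e}"])

lemma lext_add [simp]: "lext f (c + d) = lext f c + lext f d"
proof -
  let ?A = "Poly_Mapping.keys c \<union> Poly_Mapping.keys d"
  have "Poly_Mapping.keys (c + d) \<subseteq> ?A" by (rule Poly_Mapping.keys_add)
  then show ?thesis
    by (simp add: lext_superset[of ?A] lookup_add sum.distrib chain.scale_left_distrib)
qed

lemma keys_chain_scale: "Poly_Mapping.keys (chain_scale r c) \<subseteq> Poly_Mapping.keys c"
  by (auto simp: in_keys_iff)

lemma lext_scale [simp]: "lext f (chain_scale r c) = chain_scale r (lext f c)"
  by (simp add: lext_superset[OF finite_keys keys_chain_scale] lext_def[of _ c] chain.scale_sum_right)

lemma lext_uminus [simp]: "lext f (- c) = - lext f c"
  using lext_add[of f c "- c"] by (simp add: eq_neg_iff_add_eq_0 add.commute)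

lemma lext_diff [simp]: "lext f (c - d) = lext f c - lext f d"
  using lext_add[of f c "- d"] by simp

lemma lext_sum: "lext f (sum g A) = (\<Sum>x\<in>A. lext f (g x))"
  by (induction A rule: infinite_finite_induct) auto

lemma lext_lext: "lext g (lext f c) = lext (lext g \<circ> f) c"
  unfolding lext_def[of f] lext_def[of "lext g \<circ> f"] by (simp add: lext_sum)

lemma lext_cong: "(\<And>e. e \<in> Poly_Mapping.keys c \<Longrightarrow> f e = g e) \<Longrightarrow> lext f c = lext g c"
  by (simp add: lext_def)

lemma lext_diff_fun: "lext (\<lambda>e. f e - g e) c = lext f c - lext g c"
  by (simp add: lext_def sum_subtractf chain.scale_right_diff_distrib)

lemma lext_pt [simp]: "lext pt c = c"
  by (induction c rule: mpol_induct) (auto simp: chain_scale_single)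

lemma keys_lext: "Poly_Mapping.keys (lext f c) \<subseteq> (\<Union>e\<in>Poly_Mapping.keys c. Poly_Mapping.keys (f e))"
  unfolding lext_def
  by (rule order.trans[OF Poly_Mapping.keys_sum]) (intro UN_mono subset_refl keys_chain_scale)

definition restr :: "'b set \<Rightarrow> ('b \<Rightarrow>\<^sub>0 rat) \<Rightarrow> ('b \<Rightarrow>\<^sub>0 rat)" where
  "restr A = lext (\<lambda>e. if e \<in> A then pt e else 0)"

lemma lookup_restr: "Poly_Mapping.lookup (restr A c) e = (if e \<in> A then Poly_Mapping.lookup c e else 0)"
  by (induction c rule: mpol_induct)
     (auto simp: restr_def lookup_add chain_scale_single lookup_single when_def)

lemma keys_restr [simp]: "Poly_Mapping.keys (restr A c) = Poly_Mapping.keys c \<inter> A"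
  by (auto simp: in_keys_iff lookup_restr split: if_splits)

text \<open>Independence of the family indexed by edges, not of the set of its values: parallel
  edges can have the same vector and must still count as dependent.\<close>

definition lin_indep :: "('e \<Rightarrow> ('c \<Rightarrow>\<^sub>0 rat)) \<Rightarrow> 'e set \<Rightarrow> bool" where
  "lin_indep b T \<longleftrightarrow> (\<forall>c. Poly_Mapping.keys c \<subseteq> T \<longrightarrow> lext b c = 0 \<longrightarrow> c = 0)"

definition lin_gen :: "('e \<Rightarrow> ('c \<Rightarrow>\<^sub>0 rat)) \<Rightarrow> 'e set \<Rightarrow> ('c \<Rightarrow>\<^sub>0 rat) set" where
  "lin_gen b T = lext b ` {c. Poly_Mapping.keys c \<subseteq> T}"

definition lin_basis :: "('e \<Rightarrow> ('c \<Rightarrow>\<^sub>0 rat)) \<Rightarrow> 'e set \<Rightarrow> 'e set \<Rightarrow> bool" where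
  "lin_basis b E T \<longleftrightarrow> T \<subseteq> E \<and> lin_indep b T \<and> b ` E \<subseteq> lin_gen b T"

lemma lin_genI: "Poly_Mapping.keys c \<subseteq> T \<Longrightarrow> x = lext b c \<Longrightarrow> x \<in> lin_gen b T"
  by (auto simp: lin_gen_def)

lemma lin_genE:
  assumes "x \<in> lin_gen b T" obtains c where "Poly_Mapping.keys c \<subseteq> T" "x = lext b c"
  using assms by (auto simp: lin_gen_def)

lemma lin_gen_0: "0 \<in> lin_gen b T"
  by (rule lin_genI[of 0]) auto

lemma lin_gen_add: "x \<in> lin_gen b T \<Longrightarrow> y \<in> lin_gen b T \<Longrightarrow> x + y \<in> lin_gen b T"
proof (elim lin_genE)
  fix c d assume "Poly_Mapping.keys c \<subseteq> T" "x = lext b c" "Poly_Mapping.keys d \<subseteq> T" "y = lext b d"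
  then show ?thesis
    using Poly_Mapping.keys_add[of c d] by (intro lin_genI[of "c + d"]) auto
qed

lemma lin_gen_scale: "x \<in> lin_gen b T \<Longrightarrow> chain_scale r x \<in> lin_gen b T"
proof (elim lin_genE)
  fix c assume "Poly_Mapping.keys c \<subseteq> T" "x = lext b c"
  then show ?thesis
    using keys_chain_scale[of r c] by (intro lin_genI[of "chain_scale r c"]) auto
qed

lemma lin_gen_diff: "x \<in> lin_gen b T \<Longrightarrow> y \<in> lin_gen b T \<Longrightarrow> x - y \<in> lin_gen b T"
  using lin_gen_add[of x b T "chain_scale (- 1) y"] lin_gen_scale[of y b T "- 1"] by simp

lemma lin_gen_sum: "(\<And>i. i \<in> A \<Longrightarrow> f i \<in> lin_gen b T) \<Longrightarrow> sum f A \<in> lin_gen b T"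
  by (induction A rule: infinite_finite_induct) (auto intro: lin_gen_0 lin_gen_add)

lemma lin_gen_base: "e \<in> T \<Longrightarrow> b e \<in> lin_gen b T"
  by (rule lin_genI[of "pt e"]) auto

lemma lin_gen_trans:
  assumes "b ` E \<subseteq> lin_gen b T" "x \<in> lin_gen b E" shows "x \<in> lin_gen b T"
proof -
  from assms(2) obtain c where "Poly_Mapping.keys c \<subseteq> E" "x = lext b c" by (rule lin_genE)
  with assms(1) show ?thesis
    by (auto simp: lext_def intro!: lin_gen_sum lin_gen_scale)
qed

lemma lin_indep_mono: "lin_indep b T \<Longrightarrow> S \<subseteq> T \<Longrightarrow> lin_indep b S"
  by (auto simp: lin_indep_def)

lemma lin_indep_insert:
  assumes "lin_indep b T" "b e \<notin> lin_gen b T" shows "lin_indep b (insert e T)"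
  unfolding lin_indep_def
proof (intro allI impI)
  fix c assume c: "Poly_Mapping.keys c \<subseteq> insert e T" "lext b c = 0"
  define a where "a = Poly_Mapping.lookup c e"
  define d where "d = c - Poly_Mapping.single e a"
  have "Poly_Mapping.lookup d e = 0" by (simp add: d_def a_def lookup_minus)
  moreover have "Poly_Mapping.keys d \<subseteq> insert e T"
    using Poly_Mapping.keys_diff[of c "Poly_Mapping.single e a"] c(1) by (auto simp: d_def split: if_splits)
  ultimately have d: "Poly_Mapping.keys d \<subseteq> T" by (auto simp: in_keys_iff)
  have ld: "lext b d = - chain_scale a (b e)" using c(2) by (simp add: d_def)
  have "a = 0"
  proof (rule ccontr)
    assume "a \<noteq> 0"
    then have "b e = chain_scale (- 1 / a) (lext b d)" by (simp add: ld)
    moreover have "lext b d \<in> lin_gen b T" using d by (rule lin_genI) simp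
    ultimately show False using assms(2) lin_gen_scale by metis
  qed
  then have "d = c" by (simp add: d_def)
  with d c(2) assms(1) show "c = 0" by (auto simp: lin_indep_def)
qed

lemma lin_basis_exists:
  assumes "finite E" obtains T where "lin_basis b E T"
proof -
  let ?P = "\<lambda>T. T \<subseteq> E \<and> lin_indep b T"
  have "?P {}" by (simp add: lin_indep_def)
  then obtain T where T: "?P T" and max: "\<And>S. ?P S \<Longrightarrow> card S \<le> card T"
    using ex_has_greatest_nat[of ?P "{}" card "Suc (card E)"] assms by (metis card_mono le_imp_less_Suc)
  have "b e \<in> lin_gen b T" if "e \<in> E" for e
  proof (rule ccontr)
    assume e: "b e \<notin> lin_gen b T"
    then have "e \<notin> T" using lin_gen_base by metis
    moreover have "card (insert e T) \<le> card T"
      using T e that by (intro max) (auto intro: lin_indep_insert)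
    ultimately show False using T assms finite_subset by fastforce
  qed
  with T have "lin_basis b E T" by (auto simp: lin_basis_def)
  then show thesis by (rule that)
qed

text \<open>The bridge from indexed families to sets of vectors. Injectivity lets the exchange bound
  for \<open>chain.independent\<close> be read as a bound on numbers of edges.\<close>

lemma lin_indep_imp:
  assumes "lin_indep b T"
  shows "inj_on b T" "chain.independent (b ` T)"
proof -
  show inj: "inj_on b T"
  proof (rule inj_onI)
    fix e f assume *: "e \<in> T" "f \<in> T" "b e = b f"
    then have "lext b (pt e - pt f) = 0" by simp
    moreover have "Poly_Mapping.keys (pt e - pt f) \<subseteq> T"
      using Poly_Mapping.keys_diff[of "pt e" "pt f"] * by auto
    ultimately have "pt e - pt f = 0" using assms by (auto simp: lin_indep_def)
    then have "Poly_Mapping.keys (pt e) = Poly_Mapping.keys (pt f)" by simp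
    then show "e = f" by simp
  qed
  show "chain.independent (b ` T)"
    unfolding chain.independent_explicit_module
  proof (intro allI impI)
    fix A u v
    assume A: "finite A" "A \<subseteq> b ` T" "(\<Sum>v\<in>A. chain_scale (u v) v) = 0" "v \<in> A"
    obtain S where S: "S \<subseteq> T" "A = b ` S" using A(2) by (auto simp: subset_image_iff)
    have injS: "inj_on b S" using inj S(1) by (rule inj_on_subset)
    have "finite S" using A(1) S(2) injS by (simp add: finite_image_iff)
    define c where "c = (\<Sum>e\<in>S. Poly_Mapping.single e (u (b e)))"
    have lc: "Poly_Mapping.lookup c e = (if e \<in> S then u (b e) else 0)" for e
      using \<open>finite S\<close> by (simp add: c_def lookup_sum lookup_single when_def)
    have "Poly_Mapping.keys c \<subseteq> T" using S(1) by (auto simp: in_keys_iff lc split: if_splits)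
    moreover have "lext b c = 0"
      using A(3) unfolding S(2) sum.reindex[OF injS] by (simp add: c_def lext_sum)
    ultimately have "c = 0" using assms by (auto simp: lin_indep_def)
    then show "u v = 0" using lc A(4) S(2) by (metis imageE lookup_zero)
  qed
qed

lemma card_lin_indep_le:
  assumes "lin_indep b T" "T \<subseteq> E" "lin_basis b E T'" "finite E"
  shows "card T \<le> card T'"
proof -
  have "finite T'" using assms finite_subset by (auto simp: lin_basis_def)
  have "b ` T \<subseteq> chain.span (b ` T')"
  proof (intro subsetI)
    fix x assume "x \<in> b ` T"
    then have "x \<in> lin_gen b T'" using assms by (auto simp: lin_basis_def)
    then obtain c where "Poly_Mapping.keys c \<subseteq> T'" "x = lext b c" by (rule lin_genE)
    then show "x \<in> chain.span (b ` T')"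
      by (auto simp: lext_def intro!: chain.span_sum chain.span_scale intro: chain.span_base)
  qed
  then have "card (b ` T) \<le> card (b ` T')"
    using chain.independent_span_bound[of "b ` T'" "b ` T"] lin_indep_imp(2)[OF assms(1)] \<open>finite T'\<close>
    by auto
  also have "\<dots> \<le> card T'" using \<open>finite T'\<close> by (rule card_image_le)
  finally show ?thesis using lin_indep_imp(1)[OF assms(1)] by (simp add: card_image)
qed

text \<open>If some \<open>b e\<close> were outside the span, adjoining \<open>e\<close> would
  produce an independent set larger than a basis.\<close>

lemma lin_basis_card_eq:
  assumes "lin_indep b T" "T \<subseteq> E" "lin_basis b E T'" "finite E" "card T = card T'"
  shows "lin_basis b E T"
  unfolding lin_basis_def
proof (intro conjI assms subsetI)
  fix x assume "x \<in> b ` E"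
  then obtain e where e: "x = b e" "e \<in> E" by auto
  show "x \<in> lin_gen b T"
  proof (rule ccontr)
    assume x: "x \<notin> lin_gen b T"
    then have "e \<notin> T" using lin_gen_base e by metis
    moreover have "card (insert e T) \<le> card T'"
      using assms e x by (intro card_lin_indep_le[of b _ E] lin_indep_insert) auto
    ultimately show False using assms finite_subset by fastforce
  qed
qed

lemma lin_basis_card:
  "lin_basis b E T \<Longrightarrow> lin_basis b E T' \<Longrightarrow> finite E \<Longrightarrow> card T = card T'"
  by (intro antisym card_lin_indep_le[of b _ E]) (auto simp: lin_basis_def)

text \<open>
  The quotient by the span of \<open>b ` G\<close> is given by a linear map \<open>lext \<pi>\<close> with this kernel.
\<close>

lemma lin_basis_quotient:
  assumes T1: "lin_basis b G T1" and T2: "T2 \<subseteq> E - G" and G: "G \<subseteq> E"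
    and ker: "\<And>x. x \<in> lin_gen b E \<Longrightarrow> lext \<pi> x = 0 \<longleftrightarrow> x \<in> lin_gen b G"
  shows "lin_basis b E (T1 \<union> T2) \<longleftrightarrow> lin_basis (lext \<pi> \<circ> b) (E - G) T2"
proof -
  have genG: "x \<in> lin_gen b T1" if "x \<in> lin_gen b G" for x
    using T1 that lin_gen_trans[of b G T1 x] by (simp add: lin_basis_def)
  have T1G: "T1 \<subseteq> G" "lin_indep b T1" using T1 by (auto simp: lin_basis_def)
  have mono: "x \<in> lin_gen b T'" if "x \<in> lin_gen b S" "S \<subseteq> T'" for x S T'
    using that by (auto simp: lin_gen_def)
  have pi_G: "lext \<pi> x = 0" if "x \<in> lin_gen b G" for x
    using ker[of x] mono[OF that G] that by blast
  have pi: "lext (lext \<pi> \<circ> b) c = lext \<pi> (lext b c)" for c by (simp add: lext_lext)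
  have split: "c = restr T1 c + restr T2 c" if "Poly_Mapping.keys c \<subseteq> T1 \<union> T2" for c
    using that T1G T2
    by (intro poly_mapping_eqI) (auto simp: lookup_add lookup_restr in_keys_iff)
  \<comment> \<open>The part of a combination supported on \<open>T1\<close> lies in the kernel, so
    the quotient sees only the part on \<open>T2\<close>.\<close>
  have pi_split: "lext \<pi> (lext b c) = lext (lext \<pi> \<circ> b) (restr T2 c)"
    if "Poly_Mapping.keys c \<subseteq> T1 \<union> T2" for c
  proof -
    have "lext b (restr T1 c) \<in> lin_gen b G" using T1G by (intro lin_genI) auto
    then show ?thesis unfolding pi
      by (subst split[OF that]) (simp add: pi_G)
  qed
  show ?thesis
  proof
    assume B: "lin_basis b E (T1 \<union> T2)"
    show "lin_basis (lext \<pi> \<circ> b) (E - G) T2"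
      unfolding lin_basis_def
    proof (intro conjI T2 subsetI)
      show "lin_indep (lext \<pi> \<circ> b) T2"
        unfolding lin_indep_def pi
      proof (intro allI impI)
        fix c assume c: "Poly_Mapping.keys c \<subseteq> T2" "lext \<pi> (lext b c) = 0"
        \<comment> \<open>A relation in the quotient says that a combination of \<open>T2\<close>
          lies in the span of \<open>T1\<close>. This gives a relation \<open>c - d\<close>
          upstairs, and as the supports of \<open>c\<close> and \<open>d\<close> are disjoint, both
          vanish.\<close>
        have "lext b c \<in> lin_gen b E" using c(1) T2 by (intro lin_genI) auto
        with c(2) ker have "lext b c \<in> lin_gen b T1" using genG by blast
        then obtain d where d: "Poly_Mapping.keys d \<subseteq> T1" "lext b c = lext b d" by (rule lin_genE)
        have "Poly_Mapping.keys (c - d) \<subseteq> T1 \<union> T2"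
          using Poly_Mapping.keys_diff[of c d] c d by blast
        moreover have "lext b (c - d) = 0" using d by simp
        ultimately have "c - d = 0" using B unfolding lin_basis_def lin_indep_def by blast
        then have "Poly_Mapping.keys c \<subseteq> T1 \<inter> T2" using c d by auto
        then have "Poly_Mapping.keys c = {}" using T1G T2 by blast
        then show "c = 0" by (intro poly_mapping_eqI) (auto simp: in_keys_iff)
      qed
      fix x assume "x \<in> (lext \<pi> \<circ> b) ` (E - G)"
      then obtain e where e: "e \<in> E" "x = lext \<pi> (b e)" by auto
      then have "b e \<in> lin_gen b (T1 \<union> T2)" using B by (auto simp: lin_basis_def)
      then obtain c where c: "Poly_Mapping.keys c \<subseteq> T1 \<union> T2" "b e = lext b c" by (rule lin_genE)
      show "x \<in> lin_gen (lext \<pi> \<circ> b) T2"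
        using e c pi_split[OF c(1)] by (intro lin_genI[of "restr T2 c"]) auto
    qed
  next
    assume B: "lin_basis (lext \<pi> \<circ> b) (E - G) T2"
    show "lin_basis b E (T1 \<union> T2)"
      unfolding lin_basis_def
    proof (intro conjI subsetI)
      show "lin_indep b (T1 \<union> T2)"
        unfolding lin_indep_def
      proof (intro allI impI)
        fix c assume c: "Poly_Mapping.keys c \<subseteq> T1 \<union> T2" "lext b c = 0"
        have "restr T2 c = 0"
          using B pi_split[OF c(1)] c(2) by (auto simp: lin_basis_def lin_indep_def)
        then have "c = restr T1 c" using split[OF c(1)] by simp
        then have "Poly_Mapping.keys c \<subseteq> T1" by (metis keys_restr inf_le2)
        then show "c = 0" using T1G c(2) by (auto simp: lin_indep_def)
      qed
      fix x assume "x \<in> b ` E"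
      then obtain e where e: "e \<in> E" "x = b e" by auto
      show "x \<in> lin_gen b (T1 \<union> T2)"
      proof (cases "e \<in> G")
        case True
        then have "x \<in> lin_gen b T1" using e T1 by (auto simp: lin_basis_def)
        then show ?thesis by (rule mono) simp
      next
        case False
        then have "lext \<pi> x \<in> lin_gen (lext \<pi> \<circ> b) T2" using e B by (auto simp: lin_basis_def)
        then obtain c where c: "Poly_Mapping.keys c \<subseteq> T2" "lext \<pi> x = lext \<pi> (lext b c)"
          unfolding pi[symmetric] by (rule lin_genE)
        have "b e \<in> lin_gen b E" using e(1) by (rule lin_gen_base)
        moreover have "lext b c \<in> lin_gen b E" using c(1) T2 by (intro lin_genI) auto
        \<comment> \<open>\<open>x\<close> and the lift of its image differ by a kernel element,
          which \<open>T1\<close> generates. The kernel is known only inside the span of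
          \<open>E\<close>, so membership there comes first.\<close>
        ultimately have "x - lext b c \<in> lin_gen b E" unfolding e(2) by (rule lin_gen_diff)
        moreover have "lext \<pi> (x - lext b c) = 0" using c by simp
        ultimately have "x - lext b c \<in> lin_gen b T1" using ker genG by blast
        moreover have "lext b c \<in> lin_gen b T2" using c by (intro lin_genI) auto
        ultimately have "(x - lext b c) + lext b c \<in> lin_gen b (T1 \<union> T2)"
          by (intro lin_gen_add) (erule mono, simp)+
        then show ?thesis by simp
      qed
    qed (use T1G T2 G in auto)
  qed
qed

section \<open>Incidence vectors, components and cycles\<close>

definition arc_vec :: "('a,'e) pre_digraph \<Rightarrow> 'e \<Rightarrow> ('a \<Rightarrow>\<^sub>0 rat)" where
  "arc_vec H e = pt (head H e) - pt (tail H e)"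

lemma edge_boundary_eq_lext: "edge_boundary H = lext (arc_vec H)"
  by (intro ext)
     (simp add: edge_boundary_def lext_def arc_vec_def chain.scale_right_diff_distrib chain_scale_single)

lemma component_of_eq:
  "component_of H u = {w. (u, w) \<in> rtrancl_on (verts H)
     (\<Union>e\<in>arcs H. {(tail H e, head H e), (head H e, tail H e)})}"
  by (simp add: component_of_def reachable_def parcs_mk_symmetric)

text \<open>Along a path the edge vectors telescope to \<open>pt w - pt u\<close>. Conversely,
  summing coefficients over the component of \<open>u\<close> kills every edge vector, since an edge
  has both ends or neither in it, but does not kill \<open>pt w - pt u\<close> when \<open>w\<close>
  lies outside.\<close>

lemma mem_component_of_iff:
  assumes "wf_digraph H" "u \<in> verts H"
  shows "w \<in> component_of H u \<longleftrightarrow> pt w - pt u \<in> lin_gen (arc_vec H) (arcs H)"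
proof
  interpret wf_digraph H by (rule assms(1))
  assume "w \<in> component_of H u"
  then have "(u, w) \<in> rtrancl_on (verts H)
     (\<Union>e\<in>arcs H. {(tail H e, head H e), (head H e, tail H e)})" by (simp add: component_of_eq)
  then show "pt w - pt u \<in> lin_gen (arc_vec H) (arcs H)"
  proof (induction rule: rtrancl_on_induct)
    case base
    show ?case by (simp add: lin_gen_0)
  next
    case (step y z)
    then obtain e where e: "e \<in> arcs H"
      "(y = tail H e \<and> z = head H e) \<or> (y = head H e \<and> z = tail H e)" by auto
    have "arc_vec H e \<in> lin_gen (arc_vec H) (arcs H)" using e(1) by (rule lin_gen_base)
    then have "(pt y - pt u) + arc_vec H e \<in> lin_gen (arc_vec H) (arcs H)"
      "(pt y - pt u) - arc_vec H e \<in> lin_gen (arc_vec H) (arcs H)"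
      using step.IH by (auto intro: lin_gen_add lin_gen_diff)
    then show ?case using e(2) by (auto simp: arc_vec_def[of H e])
  qed
next
  interpret wf_digraph H by (rule assms(1))
  let ?C = "component_of H u"
  assume "pt w - pt u \<in> lin_gen (arc_vec H) (arcs H)"
  then obtain c where c: "Poly_Mapping.keys c \<subseteq> arcs H" "pt w - pt u = lext (arc_vec H) c"
    by (rule lin_genE)
  \<comment> \<open>The functional takes values in chains on the one-element type, so that it is
    again a \<open>lext\<close>.\<close>
  let ?\<phi> = "lext (\<lambda>v. if v \<in> ?C then pt () else 0)"
  have u: "u \<in> ?C" using assms(2) by (simp add: component_of_eq)
  have "head H e \<in> ?C \<longleftrightarrow> tail H e \<in> ?C" if "e \<in> arcs H" for e
    unfolding component_of_eq mem_Collect_eq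
    using that by (auto intro: rtrancl_on_into_rtrancl_on)
  then have "?\<phi> (arc_vec H e) = 0" if "e \<in> arcs H" for e
    using that by (auto simp: arc_vec_def)
  then have "?\<phi> (lext (arc_vec H) c) = lext (\<lambda>_. 0) c"
    unfolding lext_lext using c(1) by (intro lext_cong) auto
  also have "\<dots> = 0" by (simp add: lext_def)
  finally have "?\<phi> (pt w - pt u) = 0" by (simp add: c(2))
  moreover have "pt () \<noteq> 0" by (metis lookup_single_eq lookup_zero one_neq_zero)
  ultimately show "w \<in> ?C" using u by (auto split: if_splits)
qed

lemma component_of_refl: "u \<in> verts H \<Longrightarrow> u \<in> component_of H u"
  by (simp add: component_of_eq)

lemma component_of_subset: "component_of H u \<subseteq> verts H"
  unfolding component_of_eq by (auto dest: in_rtrancl_on_in_F)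

lemma component_of_cong:
  assumes "wf_digraph H" "u \<in> verts H" "v \<in> component_of H u"
  shows "component_of H v = component_of H u"
proof -
  have v: "v \<in> verts H" using assms(3) component_of_subset by fast
  have vu: "pt v - pt u \<in> lin_gen (arc_vec H) (arcs H)"
    using assms mem_component_of_iff by metis
  have "pt w - pt v \<in> lin_gen (arc_vec H) (arcs H) \<longleftrightarrow> pt w - pt u \<in> lin_gen (arc_vec H) (arcs H)" for w
    using lin_gen_add[OF _ vu, of "pt w - pt v"] lin_gen_diff[OF _ vu, of "pt w - pt u"] by auto
  then show ?thesis
    using mem_component_of_iff[OF assms(1,2)] mem_component_of_iff[OF assms(1) v] by blast
qed

lemma connected_iff_component_of:
  "connected H \<longleftrightarrow> verts H \<noteq> {} \<and> (\<forall>u\<in>verts H. verts H \<subseteq> component_of H u)"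
  by (auto simp: connected_def strongly_connected_def component_of_def)

text \<open>Finiteness of the edge set matters because \<open>dim\<close> is 0 also for a space with
  an infinite basis. Here the cycle space sits in the span of finitely many unit chains.\<close>

lemma h1_eq_0_iff:
  assumes "finite (arcs H)"
  shows "h1 H = 0 \<longleftrightarrow> lin_indep (arc_vec H) (arcs H)"
proof -
  have "H1 H \<subseteq> chain.span (pt ` arcs H)"
  proof
    fix c assume "c \<in> H1 H"
    then have "Poly_Mapping.keys c \<subseteq> arcs H" by (simp add: H1_def)
    then have "lext pt c \<in> chain.span (pt ` arcs H)"
      unfolding lext_def by (intro chain.span_sum chain.span_scale chain.span_base) auto
    then show "c \<in> chain.span (pt ` arcs H)" by simp
  qed
  note sub = this
  obtain B where B: "B \<subseteq> H1 H" "chain.independent B" "H1 H \<subseteq> chain.span B" "card B = chain.dim (H1 H)"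
    using chain.basis_exists by blast
  have "finite B"
    using chain.independent_span_bound[of "pt ` arcs H" B] assms B sub by auto
  have "h1 H = 0 \<longleftrightarrow> H1 H \<subseteq> {0}"
  proof
    assume "h1 H = 0"
    then have "B = {}" using B(4) \<open>finite B\<close> by (simp add: h1_def)
    then show "H1 H \<subseteq> {0}" using B(3) by simp
  next
    assume "H1 H \<subseteq> {0}"
    moreover have "0 \<notin> B" using B(2) chain.dependent_zero by metis
    ultimately have "B = {}" using B(1) by auto
    then show "h1 H = 0" using B(4) by (simp add: h1_def)
  qed
  then show ?thesis by (auto simp: H1_def lin_indep_def edge_boundary_eq_lext)
qed

text \<open>No edge leaves a component, so the boundary map splits as a direct sum over components.
  This mediates between the componentwise definition of spanning trees and the global notion of
  basis.\<close>

lemma restr_arc_vec: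
  assumes "wf_digraph H" "v \<in> verts H" "Poly_Mapping.keys c \<subseteq> arcs H"
  shows "restr (component_of H v) (lext (arc_vec H) c) =
    lext (arc_vec H) (restr {e. tail H e \<in> component_of H v} c)"
  unfolding restr_def lext_lext
proof (rule lext_cong)
  interpret wf_digraph H by (rule assms(1))
  fix e assume "e \<in> Poly_Mapping.keys c"
  then have e: "e \<in> arcs H" using assms(3) by auto
  have "head H e \<in> component_of H v \<longleftrightarrow> tail H e \<in> component_of H v"
    unfolding component_of_eq mem_Collect_eq
    using e by (auto intro: rtrancl_on_into_rtrancl_on)
  then show "(lext (\<lambda>e. if e \<in> component_of H v then pt e else 0) \<circ> arc_vec H) e =
      (lext (arc_vec H) \<circ> (\<lambda>e. if e \<in> {e. tail H e \<in> component_of H v} then pt e else 0)) e"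
    by (auto simp: arc_vec_def)
qed

text \<open>In each component, \<open>h1 = 0\<close> is independence of the edge vectors, and
  connectedness says that all differences of vertices are generated. A loop has vector 0 and thus
  lies in no basis.\<close>

lemma spanning_trees_iff_lin_basis:
  assumes "fin_digraph H"
  shows "T \<in> spanning_trees H \<longleftrightarrow> lin_basis (arc_vec H) (arcs H) T"
proof (cases "T \<subseteq> arcs H")
  case False
  then show ?thesis by (simp add: spanning_trees_def lin_basis_def)
next
  case True
  interpret fin_digraph H by (rule assms)
  have wf: "wf_digraph H" by unfold_locales
  define C where "C v = component_of H v" for v
  define K where "K v = H\<lparr>arcs := T\<rparr> \<restriction> C v" for v
  define A where "A v = {e\<in>T. tail H e \<in> C v}" for v
  have C_refl: "v \<in> C v" if "v \<in> verts H" for v using that by (simp add: C_def component_of_refl)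
  have head_tail: "head H e \<in> C v \<longleftrightarrow> tail H e \<in> C v" if "e \<in> arcs H" for e v
    unfolding C_def component_of_eq mem_Collect_eq
    using that by (auto intro: rtrancl_on_into_rtrancl_on)
  have K: "verts (K v) = C v" "arcs (K v) = A v" "tail (K v) = tail H" "head (K v) = head H" for v
    using head_tail True by (auto simp: K_def A_def induce_subgraph_def)
  have arc_vec_K: "arc_vec (K v) = arc_vec H" for v by (intro ext) (simp add: arc_vec_def K)
  have wfK: "wf_digraph (K v)" for v
    by unfold_locales (use True head_tail in \<open>auto simp: K A_def\<close>)
  have finT: "finite T" by (rule finite_subset[OF True finite_arcs])
  have tree: "is_tree (K v) \<longleftrightarrow> lin_indep (arc_vec H) (A v) \<and>
      (\<forall>u\<in>C v. \<forall>w\<in>C v. pt w - pt u \<in> lin_gen (arc_vec H) (A v))" if "v \<in> verts H" for v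
    unfolding is_tree_def connected_iff_component_of K(1)
    using C_refl[OF that] finT
    by (auto simp: h1_eq_0_iff K A_def[of v] arc_vec_K subset_iff mem_component_of_iff[OF wfK])
  have ST: "T \<in> spanning_trees H \<longleftrightarrow> (\<forall>v\<in>verts H. is_tree (K v))"
    using True by (simp add: spanning_trees_def K_def C_def)
  show ?thesis
  proof
    assume L: "T \<in> spanning_trees H"
    have tr: "lin_indep (arc_vec H) (A v)"
        "\<And>u w. u \<in> C v \<Longrightarrow> w \<in> C v \<Longrightarrow> pt w - pt u \<in> lin_gen (arc_vec H) (A v)"
      if "v \<in> verts H" for v
      using L that tree ST by auto
    show "lin_basis (arc_vec H) (arcs H) T"
      unfolding lin_basis_def
    proof (intro conjI True subsetI)
      show "lin_indep (arc_vec H) T"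
        unfolding lin_indep_def
      proof (intro allI impI)
        fix c assume c: "Poly_Mapping.keys c \<subseteq> T" "lext (arc_vec H) c = 0"
        have "Poly_Mapping.lookup c e = 0" if e: "e \<in> T" for e
        proof -
          have v: "tail H e \<in> verts H" using e True by auto
          \<comment> \<open>The part of the relation in the component of \<open>e\<close> is itself
            a relation, now between edges of a tree.\<close>
          let ?d = "restr {e'. tail H e' \<in> C (tail H e)} c"
          have "lext (arc_vec H) ?d = restr (C (tail H e)) 0"
            using restr_arc_vec[OF wf v, of c] c True by (simp add: C_def)
          also have "\<dots> = 0" by (simp add: restr_def)
          finally have "lext (arc_vec H) ?d = 0" .
          moreover have "Poly_Mapping.keys ?d \<subseteq> A (tail H e)" using c(1) by (auto simp: A_def)
          ultimately have "?d = 0" using tr(1)[OF v] unfolding lin_indep_def by blast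
          then have "Poly_Mapping.lookup ?d e = 0" by simp
          then show ?thesis using C_refl[OF v] by (simp add: lookup_restr)
        qed
        then show "c = 0" using c(1) by (intro poly_mapping_eqI) (auto simp: in_keys_iff)
      qed
      fix x assume "x \<in> arc_vec H ` arcs H"
      then obtain e where e: "e \<in> arcs H" "x = arc_vec H e" by auto
      let ?v = "tail H e"
      have "?v \<in> C ?v" "head H e \<in> C ?v" using e head_tail C_refl by auto
      then have "x \<in> lin_gen (arc_vec H) (A ?v)" using tr(2)[of ?v] e by (simp add: arc_vec_def)
      then show "x \<in> lin_gen (arc_vec H) T" by (auto simp: lin_gen_def A_def)
    qed
  next
    assume R: "lin_basis (arc_vec H) (arcs H) T"
    show "T \<in> spanning_trees H"
      unfolding ST
    proof
      fix v assume v: "v \<in> verts H"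
      show "is_tree (K v)"
        unfolding tree[OF v]
      proof (intro conjI ballI)
        show "lin_indep (arc_vec H) (A v)"
          using R by (auto simp: lin_basis_def A_def intro: lin_indep_mono)
        fix u w assume uw: "u \<in> C v" "w \<in> C v"
        have "(pt w - pt v) - (pt u - pt v) \<in> lin_gen (arc_vec H) (arcs H)"
          using uw mem_component_of_iff[OF wf v] by (intro lin_gen_diff[of "pt w - pt v" _ _ "pt u - pt v"]) (auto simp: C_def)
        then have "pt w - pt u \<in> lin_gen (arc_vec H) (arcs H)" by simp
        then have "pt w - pt u \<in> lin_gen (arc_vec H) T"
          using R lin_gen_trans by (metis lin_basis_def)
        then obtain d where d: "Poly_Mapping.keys d \<subseteq> T" "pt w - pt u = lext (arc_vec H) d"
          by (rule lin_genE)
        \<comment> \<open>Both vertices lie in \<open>C v\<close>, so cutting a combination down to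
          this component does not change its boundary.\<close>
        have "restr (C v) (pt w - pt u) = pt w - pt u"
          using uw by (simp add: restr_def)
        then have "pt w - pt u = lext (arc_vec H) (restr {e. tail H e \<in> C v} d)"
          using restr_arc_vec[OF wf v, of d] d True by (simp add: C_def)
        then show "pt w - pt u \<in> lin_gen (arc_vec H) (A v)"
          using d(1) by (intro lin_genI) (auto simp: A_def)
      qed
    qed
  qed
qed

lemma finite_spanning_trees: "finite (arcs H) \<Longrightarrow> finite (spanning_trees H)"
  by (rule finite_subset[of _ "Pow (arcs H)"]) (auto simp: spanning_trees_def)

section \<open>Subgraph, contraction, and the number of missing edges\<close>

context
  fixes \<Gamma> :: "('a,'e) pre_digraph" and G :: "'e set"
  assumes fin: "fin_digraph \<Gamma>" and G: "G \<subseteq> arcs \<Gamma>"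
begin

lemma spanning_trees_edge_subgraph:
  "T \<in> spanning_trees (edge_subgraph \<Gamma> G) \<longleftrightarrow> lin_basis (arc_vec \<Gamma>) G T"
proof -
  interpret fin_digraph \<Gamma> by (rule fin)
  have "fin_digraph (edge_subgraph \<Gamma> G)"
    using G finite_subset[OF G] by unfold_locales (auto simp: edge_subgraph_def)
  moreover have "arc_vec (edge_subgraph \<Gamma> G) = arc_vec \<Gamma>"
    by (intro ext) (simp add: arc_vec_def edge_subgraph_def)
  moreover have "arcs (edge_subgraph \<Gamma> G) = G" by (simp add: edge_subgraph_def)
  ultimately show ?thesis by (simp add: spanning_trees_iff_lin_basis)
qed

text \<open>By \<open>mem_component_of_iff\<close>, contraction identifies vertices exactly when
  their difference lies in the span of \<open>G\<close>. Sending a vertex to its class is therefore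
  a linear map to which \<open>lin_basis_quotient\<close> applies, once its kernel on the span of
  all edge vectors is determined.\<close>

lemma spanning_trees_contract:
  assumes T1: "lin_basis (arc_vec \<Gamma>) G T1" and T2: "T2 \<subseteq> arcs \<Gamma> - G"
  shows "T2 \<in> spanning_trees (contract \<Gamma> G) \<longleftrightarrow> lin_basis (arc_vec \<Gamma>) (arcs \<Gamma>) (T1 \<union> T2)"
proof -
  interpret fin_digraph \<Gamma> by (rule fin)
  let ?H = "\<Gamma>\<lparr>arcs := G\<rparr>"
  define cl where "cl = component_of ?H"
  define \<pi> where "\<pi> v = pt (cl v)" for v
  have contract: "verts (contract \<Gamma> G) = cl ` verts \<Gamma>" "arcs (contract \<Gamma> G) = arcs \<Gamma> - G"
      "tail (contract \<Gamma> G) = cl \<circ> tail \<Gamma>" "head (contract \<Gamma> G) = cl \<circ> head \<Gamma>"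
    by (simp_all add: contract_def cl_def Let_def)
  have "fin_digraph (contract \<Gamma> G)"
    by unfold_locales (auto simp: contract)
  have wfH: "wf_digraph ?H" by unfold_locales (use G in auto)
  have vecH: "arc_vec ?H = arc_vec \<Gamma>" by (intro ext) (simp add: arc_vec_def)
  have cl_iff: "w \<in> cl u \<longleftrightarrow> pt w - pt u \<in> lin_gen (arc_vec \<Gamma>) G" if "u \<in> verts \<Gamma>" for u w
    using mem_component_of_iff[OF wfH, of u w] that by (simp add: cl_def vecH)
  have vec: "arc_vec (contract \<Gamma> G) = lext \<pi> \<circ> arc_vec \<Gamma>"
    by (intro ext) (simp add: arc_vec_def contract \<pi>_def)
  have pi_G: "lext \<pi> x = 0" if x: "x \<in> lin_gen (arc_vec \<Gamma>) G" for x
  proof -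
    obtain c where c: "Poly_Mapping.keys c \<subseteq> G" "x = lext (arc_vec \<Gamma>) c" using x by (rule lin_genE)
    have "lext \<pi> (arc_vec \<Gamma> e) = 0" if "e \<in> G" for e
    proof -
      have "arc_vec \<Gamma> e \<in> lin_gen (arc_vec \<Gamma>) G" using that by (rule lin_gen_base)
      then have "head \<Gamma> e \<in> cl (tail \<Gamma> e)" using cl_iff G that by (auto simp: arc_vec_def)
      then have "cl (head \<Gamma> e) = cl (tail \<Gamma> e)"
        unfolding cl_def using G that by (intro component_of_cong[OF wfH]) auto
      then show ?thesis by (simp add: arc_vec_def \<pi>_def)
    qed
    then have "lext \<pi> x = lext (\<lambda>_. 0) c"
      unfolding c(2) lext_lext using c(1) by (intro lext_cong) auto
    then show ?thesis by (simp add: lext_def)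
  qed
  have ker: "lext \<pi> x = 0 \<longleftrightarrow> x \<in> lin_gen (arc_vec \<Gamma>) G" if x: "x \<in> lin_gen (arc_vec \<Gamma>) (arcs \<Gamma>)" for x
  proof
    assume "lext \<pi> x = 0"
    obtain c where c: "Poly_Mapping.keys c \<subseteq> arcs \<Gamma>" "x = lext (arc_vec \<Gamma>) c" using x by (rule lin_genE)
    have "Poly_Mapping.keys (arc_vec \<Gamma> e) \<subseteq> verts \<Gamma>" if "e \<in> arcs \<Gamma>" for e
      using Poly_Mapping.keys_diff[of "pt (head \<Gamma> e)" "pt (tail \<Gamma> e)"] that by (auto simp: arc_vec_def)
    then have kx: "Poly_Mapping.keys x \<subseteq> verts \<Gamma>"
      unfolding c(2) using c(1) by (intro order.trans[OF keys_lext]) blast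
    \<comment> \<open>Choosing a vertex in each class gives a section of the quotient. Each vertex
      differs from its representative by an element of the span of \<open>G\<close>, hence so does
      \<open>x\<close> from the lift of \<open>lext \<pi> x = 0\<close>.\<close>
    define r where "r S = (SOME w. w \<in> S)" for S :: "'a set"
    have "pt (r (cl v)) - pt v \<in> lin_gen (arc_vec \<Gamma>) G" if "v \<in> verts \<Gamma>" for v
    proof -
      have "v \<in> cl v" using that by (simp add: cl_def component_of_refl)
      then have "r (cl v) \<in> cl v" unfolding r_def by (rule someI)
      then show ?thesis using cl_iff[OF that] by simp
    qed
    then have "lext (\<lambda>v. pt (r (cl v)) - pt v) x \<in> lin_gen (arc_vec \<Gamma>) G"
      unfolding lext_def using kx by (intro lin_gen_sum lin_gen_scale) auto
    moreover have "lext (\<lambda>v. pt (r (cl v)) - pt v) x = lext (pt \<circ> r) (lext \<pi> x) - x"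
      unfolding lext_diff_fun lext_lext by (simp add: comp_def \<pi>_def)
    ultimately have "- x \<in> lin_gen (arc_vec \<Gamma>) G" using \<open>lext \<pi> x = 0\<close> by simp
    then show "x \<in> lin_gen (arc_vec \<Gamma>) G" using lin_gen_diff[OF lin_gen_0, of "- x"] by simp
  qed (rule pi_G)
  show ?thesis
    unfolding spanning_trees_iff_lin_basis[OF \<open>fin_digraph (contract \<Gamma> G)\<close>] contract vec
    using lin_basis_quotient[OF T1 T2 G ker] by blast
qed

text \<open>The corank of \<open>G\<close>, which is the number N of the overview. All bases have
  the same size by \<open>lin_basis_card\<close>, so the choice is harmless;
  \<open>betti_pos\<close> makes the link to \<open>h1\<close>.\<close>

definition betti :: nat where
  "betti = card G - card (SOME T. lin_basis (arc_vec \<Gamma>) G T)"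

lemma finite_G: "finite G"
  using G fin finite_subset by (metis fin_digraph.finite_arcs)

lemma card_complement_lin_basis:
  assumes "lin_basis (arc_vec \<Gamma>) G T" shows "card (G - T) = betti"
proof -
  have "T \<subseteq> G" using assms by (simp add: lin_basis_def)
  moreover have "lin_basis (arc_vec \<Gamma>) G (SOME T. lin_basis (arc_vec \<Gamma>) G T)"
    using assms by (rule someI)
  then have "card (SOME T. lin_basis (arc_vec \<Gamma>) G T) = card T"
    by (rule lin_basis_card[OF _ assms finite_G])
  ultimately show ?thesis using finite_subset[OF _ finite_G, of T] by (simp add: betti_def card_Diff_subset)
qed

lemma betti_pos:
  assumes "h1 (edge_subgraph \<Gamma> G) > 0" shows "betti > 0"
proof -
  obtain T where T: "lin_basis (arc_vec \<Gamma>) G T" using finite_G by (rule lin_basis_exists)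
  have "arc_vec (edge_subgraph \<Gamma> G) = arc_vec \<Gamma>" "arcs (edge_subgraph \<Gamma> G) = G"
    by (auto simp: arc_vec_def edge_subgraph_def)
  then have "\<not> lin_indep (arc_vec \<Gamma>) G" using assms h1_eq_0_iff[of "edge_subgraph \<Gamma> G"] finite_G by simp
  with T have "T \<subset> G" by (auto simp: lin_basis_def)
  then have "card (G - T) > 0" using finite_G by (simp add: card_gt_0_iff psubset_imp_ex_mem)
  then show ?thesis using card_complement_lin_basis[OF T] by simp
qed

text \<open>\<open>T \<inter> G\<close> is independent, so it has at most as many edges as a basis
  of \<open>G\<close>, with equality exactly when it is a basis.\<close>

lemma card_complement_spanning_tree:
  assumes "T \<in> spanning_trees \<Gamma>"
  shows "betti \<le> card (G - T)"
    and "card (G - T) = betti \<longleftrightarrow> T \<inter> G \<in> spanning_trees (edge_subgraph \<Gamma> G)"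
proof -
  have ind: "lin_indep (arc_vec \<Gamma>) (T \<inter> G)"
    using assms by (auto simp: spanning_trees_iff_lin_basis[OF fin] lin_basis_def intro: lin_indep_mono)
  obtain T' where T': "lin_basis (arc_vec \<Gamma>) G T'" using finite_G by (rule lin_basis_exists)
  have le: "card (T \<inter> G) \<le> card T'" by (rule card_lin_indep_le[OF ind _ T' finite_G]) auto
  have "T' \<subseteq> G" using T' by (simp add: lin_basis_def)
  then have card: "card (G - T') = card G - card T'" "card T' \<le> card G"
    using finite_subset[OF _ finite_G, of T'] card_mono[OF finite_G, of T'] by (auto simp: card_Diff_subset)
  have "G - T = G - T \<inter> G" by auto
  then have card': "card (G - T) = card G - card (T \<inter> G)"
    using finite_G by (simp add: card_Diff_subset)
  show "betti \<le> card (G - T)"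
    using le card card' card_complement_lin_basis[OF T'] by simp
  show "card (G - T) = betti \<longleftrightarrow> T \<inter> G \<in> spanning_trees (edge_subgraph \<Gamma> G)"
    unfolding spanning_trees_edge_subgraph
  proof
    assume "card (G - T) = betti"
    then have "card (T \<inter> G) = card T'"
      using le card card' card_complement_lin_basis[OF T'] by simp
    then show "lin_basis (arc_vec \<Gamma>) G (T \<inter> G)"
      by (intro lin_basis_card_eq[OF ind _ T' finite_G]) auto
  next
    assume "lin_basis (arc_vec \<Gamma>) G (T \<inter> G)"
    then show "card (G - T) = betti" using card_complement_lin_basis \<open>G - T = G - T \<inter> G\<close> by metis
  qed
qed

text \<open>Minimality of \<open>card (G - T)\<close> forces \<open>T \<inter> G\<close> to be a
  basis of \<open>G\<close>, and only then does \<open>spanning_trees_contract\<close> identify the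
  remaining edges of \<open>T\<close>.\<close>

lemma bij_betw_spanning_trees:
  "bij_betw (\<lambda>(T1, T2). T1 \<union> T2)
     (spanning_trees (edge_subgraph \<Gamma> G) \<times> spanning_trees (contract \<Gamma> G))
     {T \<in> spanning_trees \<Gamma>. card (G - T) = betti}"
proof (rule bij_betw_byWitness[where f' = "\<lambda>T. (T \<inter> G, T - G)"])
  have sub: "T1 \<subseteq> G" "T2 \<subseteq> arcs \<Gamma> - G"
    if "T1 \<in> spanning_trees (edge_subgraph \<Gamma> G)" "T2 \<in> spanning_trees (contract \<Gamma> G)" for T1 T2
    using that by (auto simp: spanning_trees_def edge_subgraph_def contract_def Let_def)
  have un: "T1 \<union> T2 \<in> spanning_trees \<Gamma>" "(T1 \<union> T2) \<inter> G = T1" "(T1 \<union> T2) - G = T2"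
    if "T1 \<in> spanning_trees (edge_subgraph \<Gamma> G)" "T2 \<in> spanning_trees (contract \<Gamma> G)" for T1 T2
    using sub[OF that] that spanning_trees_contract[of T1 T2]
    by (auto simp: spanning_trees_edge_subgraph spanning_trees_iff_lin_basis[OF fin])
  show "\<forall>a\<in>spanning_trees (edge_subgraph \<Gamma> G) \<times> spanning_trees (contract \<Gamma> G).
      (\<lambda>T. (T \<inter> G, T - G)) (case a of (T1, T2) \<Rightarrow> T1 \<union> T2) = a"
    using un by auto
  show "\<forall>a'\<in>{T \<in> spanning_trees \<Gamma>. card (G - T) = betti}. (case (a' \<inter> G, a' - G) of (T1, T2) \<Rightarrow> T1 \<union> T2) = a'"
    by auto
  show "(\<lambda>(T1, T2). T1 \<union> T2) ` (spanning_trees (edge_subgraph \<Gamma> G) \<times> spanning_trees (contract \<Gamma> G))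
      \<subseteq> {T \<in> spanning_trees \<Gamma>. card (G - T) = betti}"
    using un by (auto simp: card_complement_spanning_tree(2))
  show "(\<lambda>T. (T \<inter> G, T - G)) ` {T \<in> spanning_trees \<Gamma>. card (G - T) = betti}
      \<subseteq> spanning_trees (edge_subgraph \<Gamma> G) \<times> spanning_trees (contract \<Gamma> G)"
  proof clarify
    fix T assume T: "T \<in> spanning_trees \<Gamma>" "card (G - T) = betti"
    then have T1: "T \<inter> G \<in> spanning_trees (edge_subgraph \<Gamma> G)"
      using card_complement_spanning_tree(2) by blast
    have "T \<subseteq> arcs \<Gamma>" using T(1) by (simp add: spanning_trees_def)
    then have "T - G \<subseteq> arcs \<Gamma> - G" by auto
    moreover have "T \<inter> G \<union> (T - G) = T" by auto
    ultimately have "T - G \<in> spanning_trees (contract \<Gamma> G)"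
      using T(1) T1 spanning_trees_contract[of "T \<inter> G" "T - G"]
      by (simp add: spanning_trees_edge_subgraph spanning_trees_iff_lin_basis[OF fin])
    with T1 show "T \<inter> G \<in> spanning_trees (edge_subgraph \<Gamma> G) \<and> T - G \<in> spanning_trees (contract \<Gamma> G)"
      by simp
  qed
qed

end

lemma spanning_trees_nonempty:
  assumes "fin_digraph H" shows "spanning_trees H \<noteq> {}"
  using lin_basis_exists[of "arcs H" "arc_vec H"] fin_digraph.finite_arcs[OF assms]
  by (metis empty_iff spanning_trees_iff_lin_basis[OF assms])

section \<open>Ideals of blowups\<close>

lemma coords_biproj [simp]: "coords (biproj B B') = Inl ` B \<union> Inr ` B'"
  by (simp add: coords_def biproj_def)

lemma coords_single [simp]: "coords [B] = B"
  by (simp add: coords_def)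

lemma psubst_pvars_subset:
  assumes "pvars p \<subseteq> V" "\<And>v. v \<in> V \<Longrightarrow> pvars (\<theta> v) \<subseteq> W"
  shows "pvars (psubst \<theta> p) \<subseteq> W"
  using pvars_psubst[of \<theta> p] assms by blast

lemma psubst_image_subset:
  assumes "S \<subseteq> {p. pvars p \<subseteq> V}" "\<And>v. v \<in> V \<Longrightarrow> pvars (\<theta> v) \<subseteq> W"
  shows "psubst \<theta> ` S \<subseteq> {p. pvars p \<subseteq> W}"
proof (intro image_subsetI CollectI)
  fix p assume "p \<in> S"
  then show "pvars (psubst \<theta> p) \<subseteq> W"
    using assms by (intro psubst_pvars_subset[of p V]) auto
qed

lemma pideal_Un_pideal:
  assumes "A \<subseteq> {p. pvars p \<subseteq> coords Bs}" "S \<subseteq> {p. pvars p \<subseteq> coords Bs}"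
  shows "pideal Bs (A \<union> pideal Bs S) = pideal Bs (A \<union> S)"
proof
  have AS: "A \<union> S \<subseteq> {p. pvars p \<subseteq> coords Bs}" using assms by blast
  have AS': "A \<union> pideal Bs S \<subseteq> {p. pvars p \<subseteq> coords Bs}" using assms pideal_subset[OF assms(2)] by blast
  show "pideal Bs (A \<union> pideal Bs S) \<subseteq> pideal Bs (A \<union> S)"
  proof
    fix x assume "x \<in> pideal Bs (A \<union> pideal Bs S)"
    then show "x \<in> pideal Bs (A \<union> S)"
      using AS'
    proof (induction rule: pideal_induct)
      case (base x)
      then show ?case
      proof
        assume "x \<in> pideal Bs S"
        then show ?thesis
          using assms(2)
          by (induction rule: pideal_induct)
             (auto intro: pideal_base[OF AS] pideal_0[OF AS] pideal_add[OF AS] pideal_mult[OF AS])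
      qed (auto intro: pideal_base[OF AS])
    qed (auto intro: pideal_0[OF AS] pideal_add[OF AS] pideal_mult[OF AS])
  qed
  show "pideal Bs (A \<union> S) \<subseteq> pideal Bs (A \<union> pideal Bs S)"
  proof
    fix x assume "x \<in> pideal Bs (A \<union> S)"
    then show "x \<in> pideal Bs (A \<union> pideal Bs S)"
      using AS
      by (induction rule: pideal_induct)
         (auto intro: pideal_base[OF AS'] pideal_base[OF assms(2)] pideal_0[OF AS'] pideal_add[OF AS'] pideal_mult[OF AS'])
  qed
qed

lemma pideal_psubst_pideal:
  assumes S: "S \<subseteq> {p. pvars p \<subseteq> coords Bs}"
    and \<theta>: "\<And>v. v \<in> coords Bs \<Longrightarrow> pvars (\<theta> v) \<subseteq> coords Bs'"
  shows "pideal Bs' (psubst \<theta> ` pideal Bs S) = pideal Bs' (psubst \<theta> ` S)"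
proof
  have S1: "psubst \<theta> ` S \<subseteq> {p. pvars p \<subseteq> coords Bs'}"
    using S \<theta> by (rule psubst_image_subset)
  have S2: "psubst \<theta> ` pideal Bs S \<subseteq> {p. pvars p \<subseteq> coords Bs'}"
    using pideal_subset[OF S] \<theta> by (rule psubst_image_subset)
  show "pideal Bs' (psubst \<theta> ` pideal Bs S) \<subseteq> pideal Bs' (psubst \<theta> ` S)"
  proof
    fix x assume "x \<in> pideal Bs' (psubst \<theta> ` pideal Bs S)"
    then show "x \<in> pideal Bs' (psubst \<theta> ` S)"
      using S2
    proof (induction rule: pideal_induct)
      case (base x)
      then obtain y where y: "y \<in> pideal Bs S" "x = psubst \<theta> y" by auto
      from y(1) S have "psubst \<theta> y \<in> pideal Bs' (psubst \<theta> ` S)"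
      proof (induction rule: pideal_induct)
        case (mult a y)
        then show ?case
          using psubst_pvars_subset[of a "coords Bs" \<theta>] \<theta> by (auto intro!: pideal_mult[OF S1])
      qed (auto intro: pideal_base[OF S1] pideal_0[OF S1] pideal_add[OF S1])
      then show ?case by (simp add: y(2))
    qed (auto intro: pideal_0[OF S1] pideal_add[OF S1] pideal_mult[OF S1])
  qed
  show "pideal Bs' (psubst \<theta> ` S) \<subseteq> pideal Bs' (psubst \<theta> ` pideal Bs S)"
  proof
    fix x assume "x \<in> pideal Bs' (psubst \<theta> ` S)"
    then show "x \<in> pideal Bs' (psubst \<theta> ` pideal Bs S)"
      using S1
      by (induction rule: pideal_induct)
         (auto intro: pideal_base[OF S2] pideal_base[OF S] pideal_0[OF S2] pideal_add[OF S2] pideal_mult[OF S2])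
  qed
qed

lemma pull_fst_pideal:
  assumes "S \<subseteq> {p. pvars p \<subseteq> B}"
  shows "pull_fst B B' (pideal [B] S) = pideal (biproj B B') (psubst (PVar \<circ> Inl) ` S)"
  unfolding pull_fst_def by (rule pideal_psubst_pideal) (use assms in auto)

lemma pull_snd_pideal:
  assumes "S \<subseteq> {p. pvars p \<subseteq> B'}"
  shows "pull_snd B B' (pideal [B'] S) = pideal (biproj B B') (psubst (PVar \<circ> Inr) ` S)"
  unfolding pull_snd_def by (rule pideal_psubst_pideal) (use assms in auto)

lemma blowup_subset: "blowup B G f \<subseteq> {p. pvars p \<subseteq> coords (biproj B G)}"
  by (auto simp: blowup_def)

lemma psubst_Inl_subset:
  assumes "S \<subseteq> {p. pvars p \<subseteq> B}"
  shows "psubst (PVar \<circ> Inl) ` S \<subseteq> {p. pvars p \<subseteq> coords (biproj B B')}"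
  using assms by (rule psubst_image_subset) auto

text \<open>Removes the nested ideal closures, so that \<open>pideal_induct\<close> can run over the
  blowup equations and the pulled-back generators.\<close>

lemma total_transform_pideal:
  assumes "S \<subseteq> {p. pvars p \<subseteq> B}"
  shows "total_transform B G f (pideal [B] S) =
    pideal (biproj B G) (blowup B G f \<union> psubst (PVar \<circ> Inl) ` S)"
  unfolding total_transform_def pull_fst_pideal[OF assms]
  by (rule pideal_Un_pideal[OF blowup_subset psubst_Inl_subset[OF assms]])

lemma pideal_single_iff:
  assumes "pvars f \<subseteq> coords Bs"
  shows "p \<in> pideal Bs {f} \<longleftrightarrow> (\<exists>a. pvars a \<subseteq> coords Bs \<and> p = a * f)"
proof
  have S: "{f} \<subseteq> {p. pvars p \<subseteq> coords Bs}" using assms by simp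
  assume "p \<in> pideal Bs {f}"
  then show "\<exists>a. pvars a \<subseteq> coords Bs \<and> p = a * f"
    using S
  proof (induction rule: pideal_induct)
    case (base x)
    then show ?case by (intro exI[of _ 1]) simp
  next
    case zero
    then show ?case by (intro exI[of _ 0]) simp
  next
    case (add x y)
    then obtain a b where "pvars a \<subseteq> coords Bs" "x = a * f" "pvars b \<subseteq> coords Bs" "y = b * f" by auto
    then show ?case using pvars_add[of a b] by (intro exI[of _ "a + b"]) (auto simp: distrib_right)
  next
    case (mult c x)
    then obtain a where "pvars a \<subseteq> coords Bs" "x = a * f" by auto
    then show ?case using pvars_mult[of c a] mult(1) by (intro exI[of _ "c * a"]) (auto simp: mult.assoc)
  qed
next
  have S: "{f} \<subseteq> {p. pvars p \<subseteq> coords Bs}" using assms by simp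
  assume "\<exists>a. pvars a \<subseteq> coords Bs \<and> p = a * f"
  then show "p \<in> pideal Bs {f}" using pideal_mult[OF S] pideal_base[OF S] by auto
qed

text \<open>Setting all variables outside \<open>V\<close> to 0 retracts onto the polynomials in \<open>V\<close>.\<close>

lemma dvd_cofactor_pvars:
  assumes "p = a * f" "pvars p \<subseteq> V" "pvars f \<subseteq> V"
  obtains a' where "pvars a' \<subseteq> V" "p = a' * f"
proof
  define \<rho> where "\<rho> = psubst (\<lambda>v. if v \<in> V then PVar v else (0 :: ('a,'b::comm_ring_1) mpol))"
  have \<rho>: "\<rho> q = q" if "pvars q \<subseteq> V" for q
    unfolding \<rho>_def using that by (intro psubst_PVar_id) auto
  show "pvars (\<rho> a) \<subseteq> V"
    unfolding \<rho>_def by (rule psubst_pvars_subset[of _ UNIV]) auto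
  show "p = \<rho> a * f"
    using assms \<rho> by (metis \<rho>_def psubst.mult)
qed

text \<open>Shows that the elements with a power carrying \<open>x\<close> into \<open>I\<close> are
  closed under addition. One factor \<open>q1 + q2\<close> is split off, and induction is applied to
  \<open>q1 * x\<close> and \<open>q2 * x\<close>. \<open>I\<close> is only asked to absorb
  \<open>q1\<close> and \<open>q2\<close>, as it will be an ideal in restricted variables.\<close>

lemma power_add_mult_closed:
  fixes x q1 q2 :: "'r::comm_ring_1"
  assumes I: "\<And>x y. x \<in> I \<Longrightarrow> y \<in> I \<Longrightarrow> x + y \<in> I" "\<And>x. x \<in> I \<Longrightarrow> q1 * x \<in> I" "\<And>x. x \<in> I \<Longrightarrow> q2 * x \<in> I"
  assumes "q1 ^ n * x \<in> I" "q2 ^ m * x \<in> I"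
  shows "(q1 + q2) ^ (n + m) * x \<in> I"
proof -
  have pow: "(q1 + q2) ^ k * y \<in> I" if "y \<in> I" for k y
    using that by (induction k) (auto simp: mult.assoc distrib_right intro: I)
  show ?thesis
    using assms(4,5)
  proof (induction "n + m" arbitrary: n m x)
    case 0
    then show ?case by simp
  next
    case (Suc k)
    consider "n = 0" | "m = 0" | n' m' where "n = Suc n'" "m = Suc m'"
      by (cases n; cases m) auto
    then show ?case
    proof cases
      case 3
      have "q2 ^ m * (q1 * x) \<in> I" "q1 ^ n * (q2 * x) \<in> I"
        using I(2)[OF Suc(4)] I(3)[OF Suc(3)] by (simp_all add: mult_ac)
      moreover have "q1 ^ n' * (q1 * x) \<in> I" "q2 ^ m' * (q2 * x) \<in> I"
        using Suc(3,4) 3 by (simp_all add: mult_ac)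
      ultimately have "(q1 + q2) ^ (n' + m) * (q1 * x) \<in> I" "(q1 + q2) ^ (n + m') * (q2 * x) \<in> I"
        using Suc(1)[of n' m "q1 * x"] Suc(1)[of n m' "q2 * x"] Suc(2) 3 by simp_all
      then have "(q1 + q2) ^ k * (q1 * x) + (q1 + q2) ^ k * (q2 * x) \<in> I"
        using Suc(2) 3 by (intro I(1)) simp_all
      then show ?thesis unfolding Suc(2)[symmetric] by (simp add: algebra_simps)
    qed (use Suc pow in auto)
  qed
qed

section \<open>Monomials of the graph polynomial\<close>

lemma prod_PVar: "finite A \<Longrightarrow>
  (\<Prod>e\<in>A. PVar e :: ('v,'k::comm_ring_1) mpol) = Poly_Mapping.single (\<Sum>e\<in>A. Poly_Mapping.single e 1) 1"
  by (induction A rule: finite_induct) (auto simp: PVar_def mult_single)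

text \<open>Different trees have different squarefree monomials, so each coefficient is a single 1
  and nothing cancels in any characteristic.\<close>

lemma graph_poly_nonzero:
  assumes "fin_digraph H"
  shows "graph_poly H \<noteq> (0 :: ('e,'k::field) mpol)"
proof -
  interpret fin_digraph H by (rule assms)
  obtain T where T: "T \<in> spanning_trees H" using spanning_trees_nonempty[OF assms] by auto
  define mon :: "'e set \<Rightarrow> ('e \<Rightarrow>\<^sub>0 nat)" where "mon A = (\<Sum>e\<in>A. Poly_Mapping.single e 1)" for A
  have keys: "Poly_Mapping.keys (mon A) = A" if "finite A" for A
  proof -
    have "Poly_Mapping.lookup (mon A) e = (if e \<in> A then 1 else 0)" for e
      using that by (simp add: mon_def lookup_sum lookup_single when_def)
    then show ?thesis by (auto simp: in_keys_iff split: if_splits)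
  qed
  have eq: "mon (arcs H - T') = mon (arcs H - T) \<longleftrightarrow> T' = T" if "T' \<in> spanning_trees H" for T'
  proof
    assume "mon (arcs H - T') = mon (arcs H - T)"
    then have "arcs H - T' = arcs H - T" by (metis finite_Diff finite_arcs keys)
    moreover have "T \<subseteq> arcs H" "T' \<subseteq> arcs H" using T that by (simp_all add: spanning_trees_def)
    ultimately show "T' = T" by blast
  qed simp
  have "graph_poly H = (\<Sum>T'\<in>spanning_trees H. Poly_Mapping.single (mon (arcs H - T')) (1::'k))"
    by (simp add: graph_poly_def prod_PVar mon_def)
  then have "Poly_Mapping.lookup (graph_poly H) (mon (arcs H - T)) =
      (\<Sum>T'\<in>spanning_trees H. if T' = T then 1 else (0::'k))"
    by (auto simp: lookup_sum lookup_single when_def eq intro!: sum.cong)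
  also have "\<dots> = 1" using T finite_spanning_trees[of H] by simp
  finally show ?thesis by auto
qed

lemma pvars_graph_poly: "pvars (graph_poly H) \<subseteq> arcs H"
  unfolding graph_poly_def using pvars_sum pvars_prod by fastforce

text \<open>The constant term of \<open>W\<close> is not a zero divisor, so powers of the series
  variable on the left can only come from \<open>H\<close>. They are moved there one at a time by
  comparing constant terms.\<close>

lemma fps_nonzerodivisor_coeff_0:
  fixes A H W :: "'r::comm_ring_1 fps"
  assumes "fps_X ^ n * A = H * W" "\<And>x. x * fps_nth W 0 = 0 \<Longrightarrow> x = 0"
  shows "\<exists>a. fps_nth A 0 = a * fps_nth W 0"
  using assms(1)
proof (induction n arbitrary: H)
  case 0
  then have "fps_nth A 0 = fps_nth (H * W) 0" by simp
  then show ?case by (auto simp: fps_mult_nth_0)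
next
  case (Suc n)
  have "fps_nth H 0 * fps_nth W 0 = fps_nth (fps_X ^ Suc n * A) 0" by (simp only: Suc.prems fps_mult_nth_0)
  then have "fps_nth H 0 = 0" using assms(2) by simp
  then have H: "H = fps_X * fps_shift 1 H" by (intro fps_ext) auto
  have "fps_X * (fps_X ^ n * A) = fps_X * (fps_shift 1 H * W)"
    using Suc.prems by (subst (asm) H) (simp add: mult.assoc)
  then have "fps_nth (fps_X * (fps_X ^ n * A)) (Suc i) = fps_nth (fps_X * (fps_shift 1 H * W)) (Suc i)" for i
    by simp
  then have "fps_X ^ n * A = fps_shift 1 H * W" by (intro fps_ext) (simp add: mult.assoc)
  then show ?case by (rule Suc.IH)
qed

section \<open>Charts and forms on a product of two projective spaces\<close>

lemma listset_biproj: "c \<in> listset (biproj B B') \<longleftrightarrow> (\<exists>b\<in>B. \<exists>b'\<in>B'. c = [Inl b, Inr b'])"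
  by (auto simp: biproj_def set_Cons_def)

lemma dehom_ring_map: "ring_map (dehom c)"
  unfolding dehom_def by (rule ring_map_psubst)

lemma dehom_PVar: "dehom c (PVar v) = (if v \<in> set c then 1 else PVar v)"
  by (simp add: dehom_def)

lemma vanishes_onI: "p \<in> I \<Longrightarrow> vanishes_on Bs I p"
  by (auto simp: vanishes_on_def subsch_def)

text \<open>A selected coordinate becomes 1 on its chart. This is the criterion used for forms
  without common zero.\<close>

lemma vanishes_on_1I:
  assumes "\<And>c. c \<in> listset Bs \<Longrightarrow> \<exists>v\<in>set c. PVar v \<in> I"
  shows "vanishes_on Bs I (1 :: ('v,'k::comm_ring_1) mpol)"
  unfolding vanishes_on_def
proof
  fix c assume c: "c \<in> listset Bs"
  then obtain v where "v \<in> set c" "PVar v \<in> I" using assms by blast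
  moreover have "dehom c 1 = (1 :: ('v,'k) mpol)" by (rule ring_map.one[OF dehom_ring_map])
  ultimately show "dehom c 1 \<in> subsch Bs I c"
    using c by (auto simp: subsch_def dehom_PVar intro!: image_eqI[of _ _ "PVar v"])
qed

text \<open>Zero has no monomials and hence every multidegree, so it may stand among forms of degree
  one in \<open>prod_to_F\<close>.\<close>

lemma multihom_0: "multihom Bs d 0"
  by (simp add: multihom_def)

lemma multihom_PVar_Inl:
  fixes B :: "'v set" and B' :: "'w set"
  assumes "finite B" "b \<in> B"
  shows "multihom (biproj B B') (\<lambda>i. if i = 0 then 1 else 0) (PVar (Inl b))"
proof -
  have "(\<Sum>v\<in>Inl ` B. Poly_Mapping.lookup (Poly_Mapping.single (Inl b :: 'v + 'w) (1::nat)) v) = 1"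
    using assms by (simp add: lookup_single when_def sum.reindex)
  moreover have "(\<Sum>v\<in>Inr ` B'. Poly_Mapping.lookup (Poly_Mapping.single (Inl b :: 'v + 'w) (1::nat)) v) = 0"
    by (rule sum.neutral) (auto simp: lookup_single when_def)
  ultimately show ?thesis
    using assms unfolding multihom_def biproj_def
    by (auto simp: PVar_def coords_def nth_Cons' less_Suc_eq pvars_def)
qed

lemma multihom_PVar_Inr:
  fixes B :: "'v set" and B' :: "'w set"
  assumes "finite B'" "b \<in> B'"
  shows "multihom (biproj B B') (\<lambda>i. if i = 1 then 1 else 0) (PVar (Inr b))"
proof -
  have "(\<Sum>v\<in>Inr ` B'. Poly_Mapping.lookup (Poly_Mapping.single (Inr b :: 'v + 'w) (1::nat)) v) = 1"
    using assms by (simp add: lookup_single when_def sum.reindex)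
  moreover have "(\<Sum>v\<in>Inl ` B. Poly_Mapping.lookup (Poly_Mapping.single (Inr b :: 'v + 'w) (1::nat)) v) = 0"
    by (rule sum.neutral) (auto simp: lookup_single when_def)
  ultimately show ?thesis
    using assms unfolding multihom_def biproj_def
    by (auto simp: PVar_def coords_def nth_Cons' less_Suc_eq pvars_def)
qed

section \<open>The strict transform\<close>

lemma arcs_contract [simp]: "arcs (contract \<Gamma> G) = arcs \<Gamma> - G"
  by (simp add: contract_def Let_def)

lemma arcs_edge_subgraph [simp]: "arcs (edge_subgraph \<Gamma> G) = G"
  by (simp add: edge_subgraph_def)

text \<open>
  The degeneration of the blowup to the normal cone: \<open>A\<^sub>g \<mapsto> t B\<^sub>g\<close> for \<open>g \<in> G\<close>, with constant
  term the restriction to \<open>F\<close>. The order in \<open>t\<close> measures the order of vanishing along \<open>F\<close>.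
\<close>

definition cone_coord :: "'e set \<Rightarrow> 'e + 'e \<Rightarrow> ('e + 'e,'k::comm_ring_1) mpol fps" where
  "cone_coord G = case_sum
     (\<lambda>e. if e \<in> G then fps_X * fps_const (PVar (Inl e)) else fps_const (PVar (Inr e)))
     (\<lambda>e. fps_const (PVar (Inl e)))"

definition cone_eval :: "'e set \<Rightarrow> ('e + 'e,'k::comm_ring_1) mpol \<Rightarrow> ('e + 'e,'k) mpol fps" where
  "cone_eval G = peval (fps_const \<circ> PConst) (cone_coord G)"

interpretation cone: eval_map "fps_const \<circ> PConst :: 'k::comm_ring_1 \<Rightarrow> ('v,'k) mpol fps"
  by unfold_locales simp_all

interpretation cone_eval: ring_map "cone_eval G" for G
  unfolding cone_eval_def by unfold_locales simp_all

lemma cone_eval_PVar [simp]: "cone_eval G (PVar v) = cone_coord G v"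
  by (simp add: cone_eval_def)

text \<open>Taking the constant coefficient is a ring map, so agreement on variables suffices: at t
  = 0 the coordinates A_g with g in \<open>G\<close> vanish.\<close>

lemma cone_eval_nth_0:
  "fps_nth (cone_eval G p) 0 = psubst (prod_to_F G) (p :: ('e + 'e,'k::comm_ring_1) mpol)"
proof -
  let ?h = "\<lambda>f :: ('e + 'e,'k) mpol fps. fps_nth f 0"
  have h: "ring_map ?h" by unfold_locales simp_all
  have "?h \<circ> cone_coord G = prod_to_F G"
    by (intro ext) (auto simp: cone_coord_def prod_to_F_def split: sum.split)
  moreover have "?h \<circ> (fps_const \<circ> PConst) = PConst" by (intro ext) simp
  ultimately show ?thesis
    using peval_hom[OF h, of "fps_const \<circ> PConst" "cone_coord G" p]
    by (simp add: cone_eval_def psubst_eq_peval)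
qed

lemma fps_X_mult_fls_X_inv:
  "fps_to_fls (fps_X * f) * fls_X_inv = fps_to_fls (f :: 'r::comm_ring_1 fps)"
proof -
  have "(fls_X :: 'r fls) * fls_X_inv = 1"
    by (simp add: fls_X_inv_times_conv_shift)
  then show ?thesis
    by (simp add: fls_times_fps_to_fls mult_ac) (metis mult.assoc mult.commute mult.left_neutral)
qed

text \<open>
  In Laurent series, sending \<open>A\<^sub>g\<close> to \<open>t B\<^sub>g\<close> and the Rees parameter to \<open>1/t\<close> factors this map
  through the Rees algebra.
\<close>

lemma cone_eval_blowup:
  assumes p: "p \<in> blowup E G PVar"
  shows "cone_eval G p = (0 :: ('e + 'e,'k::comm_ring_1) mpol fps)"
proof -
  define \<kappa> :: "'k \<Rightarrow> ('e + 'e,'k) mpol fls" where "\<kappa> = fps_to_fls \<circ> (fps_const \<circ> PConst)"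
  define \<theta> where "\<theta> = case_option fls_X_inv (\<lambda>e. fps_to_fls (cone_coord G (Inl e) :: ('e + 'e,'k) mpol fps))"
  have emb: "ring_map (fps_to_fls :: ('e + 'e,'k) mpol fps \<Rightarrow> _)"
    by unfold_locales (simp_all add: fls_times_fps_to_fls)
  have \<kappa>: "ring_map \<kappa>"
    unfolding \<kappa>_def by (rule ring_map_comp[OF cone.ring_map_axioms emb])
  interpret \<kappa>: eval_map \<kappa> using \<kappa> by (simp add: eval_map_def)
  define \<beta> :: "'e + 'e \<Rightarrow> ('e option,'k) mpol" where
    "\<beta> = case_sum (PVar \<circ> Some) (\<lambda>g. psubst (PVar \<circ> Some) (PVar g) * PVar None)"
  \<comment> \<open>For g in \<open>G\<close> the factor t in the image of A_g cancels the 1/t of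
    the Rees parameter. Outside \<open>G\<close> there is no such factor, hence the restriction to
    variables of \<open>p\<close>.\<close>
  have \<beta>: "(peval \<kappa> \<theta> \<circ> \<beta>) v = (fps_to_fls \<circ> cone_coord G) v" if "v \<in> pvars p" for v
  proof (cases v)
    case (Inr g)
    then have "g \<in> G" using that p by (auto simp: blowup_def)
    then show ?thesis
      using Inr fps_X_mult_fls_X_inv[of "fps_const (PVar (Inl g)) :: ('e + 'e,'k) mpol fps"]
      by (simp add: \<beta>_def \<theta>_def cone_coord_def)
  qed (simp add: \<beta>_def \<theta>_def)
  have "fps_to_fls (cone_eval G p) = peval \<kappa> (fps_to_fls \<circ> cone_coord G) p"
    unfolding cone_eval_def \<kappa>_def by (rule peval_hom[OF emb])
  also have "\<dots> = peval \<kappa> (peval \<kappa> \<theta> \<circ> \<beta>) p"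
    by (rule peval_cong) (rule \<beta>[symmetric])
  also have "\<dots> = peval \<kappa> \<theta> (psubst \<beta> p)" by (rule peval_psubst[OF \<kappa>, symmetric])
  also have "psubst \<beta> p = 0" using p unfolding blowup_def \<beta>_def by blast
  finally show ?thesis by simp
qed

section \<open>Restriction of the strict transform to F\<close>

context
  fixes \<Gamma> :: "('a,'e) pre_digraph" and G :: "'e set"
    and K :: "'k::field itself" \<comment> \<open>only fixes the coefficient field\<close>
  assumes fin: "fin_digraph \<Gamma>" and G: "G \<subseteq> arcs \<Gamma>"
begin

abbreviation (input) \<Psi> :: "('e + 'e,'k) mpol" where
  "\<Psi> \<equiv> psubst (PVar \<circ> Inl) (graph_poly \<Gamma>)"

abbreviation (input) \<Psi>\<^sub>G :: "('e + 'e,'k) mpol" where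
  "\<Psi>\<^sub>G \<equiv> psubst (PVar \<circ> Inl) (graph_poly (edge_subgraph \<Gamma> G))"

abbreviation (input) \<Psi>\<^sub>Q :: "('e + 'e,'k) mpol" where
  "\<Psi>\<^sub>Q \<equiv> psubst (PVar \<circ> Inr) (graph_poly (contract \<Gamma> G))"

abbreviation (input) V :: "('e + 'e) set" where
  "V \<equiv> coords (biproj G (arcs \<Gamma> - G))"

text \<open>The term of \<open>T\<close> with its variables distributed over the two factors of F.
  Its full image under \<open>cone_eval\<close> carries the extra factor t to the power
  \<open>card (G - T)\<close>.\<close>

definition tree_term :: "'e set \<Rightarrow> ('e + 'e,'k) mpol" where
  "tree_term T = (\<Prod>e\<in>G - T. PVar (Inl e)) * (\<Prod>e\<in>arcs \<Gamma> - G - T. PVar (Inr e))"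

lemma finite_arcs_\<Gamma>: "finite (arcs \<Gamma>)"
  using fin by (rule fin_digraph.finite_arcs)

lemma finite_trees: "finite (spanning_trees \<Gamma>)"
  by (rule finite_spanning_trees[OF finite_arcs_\<Gamma>])

lemma fin_contract: "fin_digraph (contract \<Gamma> G)"
proof -
  interpret fin_digraph \<Gamma> by (rule fin)
  show ?thesis by unfold_locales (auto simp: contract_def Let_def)
qed

lemma fin_edge_subgraph: "fin_digraph (edge_subgraph \<Gamma> G)"
  using finite_subset[OF G finite_arcs_\<Gamma>] by unfold_locales (auto simp: edge_subgraph_def)

text \<open>The product runs over pairs of trees; \<open>bij_betw_spanning_trees\<close> turns pairs
  into trees of \<open>\<Gamma>\<close>, and the complements of a union separate into those of its
  parts.\<close>

lemma leading_terms: "\<Psi>\<^sub>G * \<Psi>\<^sub>Q = (\<Sum>T | T \<in> spanning_trees \<Gamma> \<and> card (G - T) = betti \<Gamma> G. tree_term T)"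
proof -
  let ?S = "spanning_trees (edge_subgraph \<Gamma> G)" and ?C = "spanning_trees (contract \<Gamma> G)"
  have "\<Psi>\<^sub>G * \<Psi>\<^sub>Q = (\<Sum>T1\<in>?S. \<Sum>T2\<in>?C.
      (\<Prod>e\<in>G - T1. PVar (Inl e)) * (\<Prod>e\<in>arcs \<Gamma> - G - T2. PVar (Inr e)))"
    by (simp add: graph_poly_def psubst.sum psubst.prod sum_product)
  also have "\<dots> = (\<Sum>(T1, T2)\<in>?S \<times> ?C.
      (\<Prod>e\<in>G - T1. PVar (Inl e)) * (\<Prod>e\<in>arcs \<Gamma> - G - T2. PVar (Inr e)))"
    by (simp add: sum.cartesian_product)
  also have "\<dots> = (\<Sum>x\<in>?S \<times> ?C. tree_term (case x of (T1, T2) \<Rightarrow> T1 \<union> T2))"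
  proof (rule sum.cong[OF refl])
    fix x assume "x \<in> ?S \<times> ?C"
    then obtain T1 T2 where x: "x = (T1, T2)" "T1 \<subseteq> G" "T2 \<subseteq> arcs \<Gamma> - G"
      by (auto simp: spanning_trees_def)
    then have "G - (T1 \<union> T2) = G - T1" "arcs \<Gamma> - G - (T1 \<union> T2) = arcs \<Gamma> - G - T2" by auto
    then show "(case x of (T1, T2) \<Rightarrow>
        (\<Prod>e\<in>G - T1. PVar (Inl e)) * (\<Prod>e\<in>arcs \<Gamma> - G - T2. PVar (Inr e))) =
        tree_term (case x of (T1, T2) \<Rightarrow> T1 \<union> T2)"
      by (simp add: x(1) tree_term_def)
  qed
  also have "\<dots> = (\<Sum>T | T \<in> spanning_trees \<Gamma> \<and> card (G - T) = betti \<Gamma> G. tree_term T)"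
    by (rule sum.reindex_bij_betw[OF bij_betw_spanning_trees[OF fin G]])
  finally show ?thesis .
qed

lemma cone_eval_\<Psi>:
  obtains W where "cone_eval G \<Psi> = fps_X ^ betti \<Gamma> G * W" "fps_nth W 0 = \<Psi>\<^sub>G * \<Psi>\<^sub>Q"
proof
  let ?N = "betti \<Gamma> G"
  \<comment> \<open>The truncated subtraction is exact because every tree misses at least
    \<open>?N\<close> edges of \<open>G\<close>; the exponent is 0 just for the trees missing
    exactly \<open>?N\<close>.\<close>
  define W where "W = (\<Sum>T\<in>spanning_trees \<Gamma>. fps_X ^ (card (G - T) - ?N) * fps_const (tree_term T))"
  have "(\<Prod>e\<in>arcs \<Gamma> - T. cone_coord G (Inl e)) = fps_X ^ card (G - T) * fps_const (tree_term T)"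
    for T :: "'e set"
  proof -
    interpret c: ring_map "fps_const :: ('e + 'e,'k) mpol \<Rightarrow> _" by unfold_locales simp_all
    have "arcs \<Gamma> - T = (G - T) \<union> (arcs \<Gamma> - G - T)" "(G - T) \<inter> (arcs \<Gamma> - G - T) = {}"
      using G by auto
    then have "(\<Prod>e\<in>arcs \<Gamma> - T. cone_coord G (Inl e)) =
        (\<Prod>e\<in>G - T. cone_coord G (Inl e)) * (\<Prod>e\<in>arcs \<Gamma> - G - T. cone_coord G (Inl e))"
      using prod.union_disjoint[of "G - T" "arcs \<Gamma> - G - T"] finite_arcs_\<Gamma> finite_subset[OF G] by simp
    also have "(\<Prod>e\<in>G - T. cone_coord G (Inl e)) =
        (\<Prod>e\<in>G - T. fps_X * fps_const (PVar (Inl e) :: ('e + 'e,'k) mpol))"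
      by (intro prod.cong) (auto simp: cone_coord_def)
    also have "\<dots> = fps_X ^ card (G - T) * fps_const (\<Prod>e\<in>G - T. PVar (Inl e))"
      by (simp add: prod.distrib c.prod)
    also have "(\<Prod>e\<in>arcs \<Gamma> - G - T. cone_coord G (Inl e)) =
        (\<Prod>e\<in>arcs \<Gamma> - G - T. fps_const (PVar (Inr e) :: ('e + 'e,'k) mpol))"
      by (intro prod.cong) (auto simp: cone_coord_def)
    also have "\<dots> = fps_const (\<Prod>e\<in>arcs \<Gamma> - G - T. PVar (Inr e))"
      by (simp add: c.prod)
    finally show ?thesis by (simp only: tree_term_def mult.assoc fps_const_mult)
  qed
  then have "cone_eval G \<Psi> =
      (\<Sum>T\<in>spanning_trees \<Gamma>. fps_X ^ card (G - T) * fps_const (tree_term T))"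
    by (simp add: graph_poly_def psubst.sum psubst.prod cone_eval.sum cone_eval.prod)
  also have "\<dots> = (\<Sum>T\<in>spanning_trees \<Gamma>.
      fps_X ^ ?N * (fps_X ^ (card (G - T) - ?N) * fps_const (tree_term T)))"
  proof (rule sum.cong[OF refl])
    fix T assume "T \<in> spanning_trees \<Gamma>"
    then have "?N \<le> card (G - T)" by (rule card_complement_spanning_tree(1)[OF fin G])
    then show "fps_X ^ card (G - T) * fps_const (tree_term T) =
        fps_X ^ ?N * (fps_X ^ (card (G - T) - ?N) * fps_const (tree_term T))"
      by (simp add: mult.assoc[symmetric] flip: power_add)
  qed
  also have "\<dots> = fps_X ^ ?N * W" by (simp add: W_def sum_distrib_left)
  finally show "cone_eval G \<Psi> = fps_X ^ ?N * W" .
  have "fps_nth W 0 = (\<Sum>T\<in>spanning_trees \<Gamma>. if card (G - T) = ?N then tree_term T else 0)"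
    unfolding W_def fps_sum_nth
  proof (rule sum.cong[OF refl])
    fix T assume "T \<in> spanning_trees \<Gamma>"
    then have "?N \<le> card (G - T)" by (rule card_complement_spanning_tree(1)[OF fin G])
    then show "fps_nth (fps_X ^ (card (G - T) - ?N) * fps_const (tree_term T)) 0 =
        (if card (G - T) = ?N then tree_term T else 0)"
      by auto
  qed
  also have "\<dots> = \<Psi>\<^sub>G * \<Psi>\<^sub>Q"
    unfolding leading_terms using finite_trees by (simp add: sum.inter_filter)
  finally show "fps_nth W 0 = \<Psi>\<^sub>G * \<Psi>\<^sub>Q" .
qed

lemma \<Psi>\<^sub>G_nonzero: "\<Psi>\<^sub>G \<noteq> 0"
proof -
  have "psubst (case_sum PVar (\<lambda>_. 0)) \<Psi>\<^sub>G = (graph_poly (edge_subgraph \<Gamma> G) :: ('e,'k) mpol)"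
    unfolding psubst_psubst by (rule psubst_PVar_id) simp
  then show ?thesis using graph_poly_nonzero[OF fin_edge_subgraph] by (metis psubst.zero)
qed

lemma \<Psi>\<^sub>Q_nonzero: "\<Psi>\<^sub>Q \<noteq> 0"
proof -
  have "psubst (case_sum (\<lambda>_. 0) PVar) \<Psi>\<^sub>Q = (graph_poly (contract \<Gamma> G) :: ('e,'k) mpol)"
    unfolding psubst_psubst by (rule psubst_PVar_id) simp
  then show ?thesis using graph_poly_nonzero[OF fin_contract] by (metis psubst.zero)
qed

lemma pvars_\<Psi>: "pvars \<Psi> \<subseteq> coords (biproj (arcs \<Gamma>) G)"
  by (rule psubst_pvars_subset[OF pvars_graph_poly]) auto

lemma pvars_\<Psi>\<^sub>G: "pvars \<Psi>\<^sub>G \<subseteq> V"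
  by (rule psubst_pvars_subset[OF pvars_graph_poly]) auto

lemma pvars_\<Psi>\<^sub>Q: "pvars \<Psi>\<^sub>Q \<subseteq> V"
  by (rule psubst_pvars_subset[OF pvars_graph_poly]) auto

lemma pvars_\<Psi>\<^sub>G\<^sub>Q: "pvars (\<Psi>\<^sub>G * \<Psi>\<^sub>Q) \<subseteq> V"
  by (rule pvars_mult_subset[OF pvars_\<Psi>\<^sub>G pvars_\<Psi>\<^sub>Q])

lemma exc_F_pideal:
  "exc_F \<Gamma> G = pideal (biproj (arcs \<Gamma>) G) (blowup (arcs \<Gamma>) G PVar \<union> (PVar \<circ> Inl) ` G)"
  unfolding exc_F_def exceptional_locus_def
  by (subst total_transform_pideal) (use G in \<open>auto simp: image_image\<close>)

lemma exc_F_generators: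
  "blowup (arcs \<Gamma>) G PVar \<union> (PVar \<circ> Inl) ` G \<subseteq> {p. pvars p \<subseteq> coords (biproj (arcs \<Gamma>) G)}"
  using blowup_subset[of "arcs \<Gamma>" G PVar] G by auto

lemma total_X_pideal:
  "total_transform (arcs \<Gamma>) G PVar (X_graph \<Gamma>) =
   pideal (biproj (arcs \<Gamma>) G) (blowup (arcs \<Gamma>) G PVar \<union> {\<Psi>})"
proof -
  have "{graph_poly \<Gamma>} \<subseteq> {p. pvars p \<subseteq> arcs \<Gamma>}" using pvars_graph_poly[of \<Gamma>] by simp
  from total_transform_pideal[OF this] show ?thesis by (simp only: X_graph_def image_insert image_empty)
qed

lemma total_X_generators:
  "blowup (arcs \<Gamma>) G PVar \<union> {\<Psi>} \<subseteq> {p. pvars p \<subseteq> coords (biproj (arcs \<Gamma>) G)}"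
  using blowup_subset[of "arcs \<Gamma>" G PVar] pvars_\<Psi> by auto

text \<open>For an equation of the blowup the whole series under \<open>cone_eval\<close> is 0, in
  particular its constant coefficient, so these equations never have to be listed.\<close>

lemma prod_to_F_exc_F:
  assumes "p \<in> exc_F \<Gamma> G" shows "psubst (prod_to_F G) p = (0 :: ('e + 'e,'k) mpol)"
  using assms exc_F_generators unfolding exc_F_pideal
proof (induction rule: pideal_induct)
  case (base p)
  then show ?case
  proof
    assume "p \<in> blowup (arcs \<Gamma>) G PVar"
    then show ?thesis by (simp add: cone_eval_blowup flip: cone_eval_nth_0)
  qed (auto simp: prod_to_F_def)
qed simp_all

lemma pvars_prod_to_F:
  assumes "pvars p \<subseteq> coords (biproj (arcs \<Gamma>) G)"
  shows "pvars (psubst (prod_to_F G) p :: ('e + 'e,'k) mpol) \<subseteq> V"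
  using assms by (rule psubst_pvars_subset) (auto simp: prod_to_F_def split: if_splits)

text \<open>The power of \<open>PVar (Inl g)\<close> is what remains of A_g^n after t^n has been
  cancelled. It becomes 1 on each chart that selects this coordinate.\<close>

lemma strict_Y_restriction:
  assumes y: "y \<in> (strict_Y \<Gamma> G :: ('e + 'e,'k) mpol set)" and g: "g \<in> G"
  obtains n h where "pvars h \<subseteq> V" "PVar (Inl g) ^ n * psubst (prod_to_F G) y = h * (\<Psi>\<^sub>G * \<Psi>\<^sub>Q)"
proof -
  let ?N = "betti \<Gamma> G"
  let ?a = "PVar (Inl g) :: ('e + 'e,'k) mpol"
  have "?a \<in> exc_F \<Gamma> G"
    unfolding exc_F_pideal using g by (intro pideal_base[OF exc_F_generators]) auto
  then obtain n where n: "?a ^ n * y \<in> pideal (biproj (arcs \<Gamma>) G) (blowup (arcs \<Gamma>) G PVar \<union> {\<Psi>})"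
    using y unfolding strict_Y_def strict_transform_def closure_of_diff_def total_X_pideal
    by (auto simp: exc_F_def)
  \<comment> \<open>Divisibility passes to sums and multiples, and the blowup equations have image
    0, so only the generator \<open>\<Psi>\<close> contributes.\<close>
  have "cone_eval G \<Psi> dvd cone_eval G z"
    if "z \<in> pideal (biproj (arcs \<Gamma>) G) (blowup (arcs \<Gamma>) G PVar \<union> {\<Psi>})" for z
    using that total_X_generators
  proof (induction rule: pideal_induct)
    case (base z)
    then show ?case by (elim UnE) (simp_all only: cone_eval_blowup dvd_0_right singleton_iff dvd_refl)
  qed simp_all
  from this[OF n] obtain H where "cone_eval G (?a ^ n * y) = cone_eval G \<Psi> * H" by (rule dvdE)
  moreover obtain W where W: "cone_eval G \<Psi> = fps_X ^ ?N * W" "fps_nth W 0 = \<Psi>\<^sub>G * \<Psi>\<^sub>Q"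
    by (rule cone_eval_\<Psi>)
  ultimately have "(fps_X * fps_const ?a) ^ n * cone_eval G y = fps_X ^ ?N * W * H"
    using g by (simp add: cone_coord_def)
  \<comment> \<open>The exponent \<open>n\<close> is not related to \<open>?N\<close>; t to the
    power \<open>?N\<close> is absorbed into the cofactor, leaving \<open>W\<close> with its nonzero
    constant term.\<close>
  then have eq: "fps_X ^ n * (fps_const (?a ^ n) * cone_eval G y) = (fps_X ^ ?N * H) * W"
    by (simp add: power_mult_distrib mult_ac)
  have "x = 0" if "x * fps_nth W 0 = 0" for x
    using mpol_no_zero_divisors[OF that[unfolded W(2)]] mpol_no_zero_divisors[of "\<Psi>\<^sub>G" "\<Psi>\<^sub>Q"]
      \<Psi>\<^sub>G_nonzero \<Psi>\<^sub>Q_nonzero by blast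
  from fps_nonzerodivisor_coeff_0[OF eq this] obtain a where
    a: "?a ^ n * psubst (prod_to_F G) y = a * (\<Psi>\<^sub>G * \<Psi>\<^sub>Q)"
    by (auto simp: W(2) cone_eval_nth_0)
  \<comment> \<open>The cofactor \<open>a\<close> is a coefficient of an arbitrary series and may
    contain foreign variables, which \<open>dvd_cofactor_pvars\<close> removes.\<close>
  have "pvars y \<subseteq> coords (biproj (arcs \<Gamma>) G)"
    using y by (simp add: strict_Y_def strict_transform_def closure_of_diff_def)
  then have "pvars (?a ^ n * psubst (prod_to_F G) y) \<subseteq> V"
    using g by (intro pvars_mult_subset pvars_power_subset pvars_prod_to_F) auto
  then obtain h where "pvars h \<subseteq> V" "?a ^ n * psubst (prod_to_F G) y = h * (\<Psi>\<^sub>G * \<Psi>\<^sub>Q)"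
    using dvd_cofactor_pvars[OF a _ pvars_\<Psi>\<^sub>G\<^sub>Q] by blast
  then show thesis by (rule that)
qed

text \<open>Since A_g is B_g times the exceptional equation, dividing the term of \<open>T\<close>
  means replacing N of its factors A_g by B_g. Which edges of \<open>G - T\<close> are taken is
  immaterial: two choices differ by an element of the blowup ideal.\<close>

definition lift_set :: "'e set \<Rightarrow> 'e set" where
  "lift_set T = (SOME S. S \<subseteq> G - T \<and> card S = betti \<Gamma> G)"

lemma lift_set:
  assumes "T \<in> spanning_trees \<Gamma>"
  shows "lift_set T \<subseteq> G - T" "card (lift_set T) = betti \<Gamma> G"
proof -
  obtain S where "S \<subseteq> G - T" "card S = betti \<Gamma> G"
    using obtain_subset_with_card_n[OF card_complement_spanning_tree(1)[OF fin G assms]] by metis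
  then have "\<exists>S. S \<subseteq> G - T \<and> card S = betti \<Gamma> G" by blast
  from someI_ex[OF this] show "lift_set T \<subseteq> G - T" "card (lift_set T) = betti \<Gamma> G"
    by (simp_all add: lift_set_def)
qed

text \<open>
  An equation of the strict transform: \<open>\<Psi>\<close> divided by the \<open>betti\<close>-th power of the
  exceptional divisor.
\<close>

definition lift_poly :: "('e + 'e,'k) mpol" where
  "lift_poly = (\<Sum>T\<in>spanning_trees \<Gamma>.
     (\<Prod>e\<in>lift_set T. PVar (Inr e)) * (\<Prod>e\<in>arcs \<Gamma> - T - lift_set T. PVar (Inl e)))"

lemma pvars_lift_poly: "pvars lift_poly \<subseteq> coords (biproj (arcs \<Gamma>) G)"
proof
  fix v assume "v \<in> pvars lift_poly"
  then obtain T where T: "T \<in> spanning_trees \<Gamma>" and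
    "v \<in> pvars ((\<Prod>e\<in>lift_set T. PVar (Inr e) :: ('e + 'e,'k) mpol) *
       (\<Prod>e\<in>arcs \<Gamma> - T - lift_set T. PVar (Inl e)))"
    unfolding lift_poly_def by (auto dest!: subsetD[OF pvars_sum])
  then have "v \<in> Inr ` lift_set T \<union> Inl ` (arcs \<Gamma> - T - lift_set T)"
    by (auto dest!: subsetD[OF pvars_mult] subsetD[OF pvars_prod])
  then show "v \<in> coords (biproj (arcs \<Gamma>) G)" using lift_set(1)[OF T] by auto
qed

text \<open>If \<open>T\<close> misses more than N edges of \<open>G\<close>, some factor A_e with e
  in \<open>G\<close> is left unreplaced and restricts to 0. If it misses exactly N, all of them are
  replaced and \<open>tree_term T\<close> results.\<close>

lemma restriction_lift_poly: "psubst (prod_to_F G) lift_poly = \<Psi>\<^sub>G * \<Psi>\<^sub>Q"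
proof -
  have "psubst (prod_to_F G) lift_poly = (\<Sum>T\<in>spanning_trees \<Gamma>.
      (\<Prod>e\<in>lift_set T. prod_to_F G (Inr e)) * (\<Prod>e\<in>arcs \<Gamma> - T - lift_set T. prod_to_F G (Inl e)))"
    by (simp add: lift_poly_def psubst.sum psubst.prod)
  also have "\<dots> = (\<Sum>T\<in>spanning_trees \<Gamma>. if card (G - T) = betti \<Gamma> G then tree_term T else 0)"
  proof (rule sum.cong[OF refl])
    fix T assume T: "T \<in> spanning_trees \<Gamma>"
    have fG: "finite (G - T)" using finite_subset[OF G finite_arcs_\<Gamma>] by simp
    show "(\<Prod>e\<in>lift_set T. prod_to_F G (Inr e)) *
        (\<Prod>e\<in>arcs \<Gamma> - T - lift_set T. prod_to_F G (Inl e)) =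
        (if card (G - T) = betti \<Gamma> G then tree_term T else (0 :: ('e + 'e,'k) mpol))"
    proof (cases "card (G - T) = betti \<Gamma> G")
      case True
      then have eq: "lift_set T = G - T"
        using lift_set[OF T] card_subset_eq[OF fG] by simp
      have "arcs \<Gamma> - T - lift_set T = arcs \<Gamma> - G - T" by (auto simp: eq)
      then show ?thesis
        unfolding tree_term_def eq using True
        by (auto simp: prod_to_F_def intro!: arg_cong2[of _ _ _ _ "(*)"] prod.cong)
    next
      case False
      then have "lift_set T \<noteq> G - T" using lift_set[OF T] by auto
      then obtain e where e: "e \<in> G - T" "e \<notin> lift_set T" using lift_set(1)[OF T] by auto
      have "(\<Prod>e\<in>arcs \<Gamma> - T - lift_set T. prod_to_F G (Inl e)) = (0 :: ('e + 'e,'k) mpol)"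
        using e G finite_arcs_\<Gamma> by (intro prod_zero) (auto simp: prod_to_F_def intro!: bexI[of _ e])
      then show ?thesis using False by simp
    qed
  qed
  also have "\<dots> = \<Psi>\<^sub>G * \<Psi>\<^sub>Q"
    unfolding leading_terms using finite_trees by (simp add: sum.inter_filter)
  finally show ?thesis .
qed

text \<open>Every tree has exactly N factors replaced, so the Rees map sends
  \<open>lift_poly\<close> to the N-th power of the Rees parameter times the graph polynomial. The
  power of \<open>PVar (Inr g)\<close> supplies the same parameter, together with A_g^N.\<close>

lemma lift_poly_blowup:
  assumes g: "g \<in> G"
  shows "PVar (Inl g) ^ betti \<Gamma> G * lift_poly - PVar (Inr g) ^ betti \<Gamma> G * \<Psi> \<in> blowup (arcs \<Gamma>) G PVar"
proof -
  let ?N = "betti \<Gamma> G"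
  define \<beta> :: "'e + 'e \<Rightarrow> ('e option,'k) mpol" where
    "\<beta> = case_sum (PVar \<circ> Some) (\<lambda>g. psubst (PVar \<circ> Some) (PVar g) * PVar None)"
  have \<beta>: "\<beta> (Inl e) = PVar (Some e)" "\<beta> (Inr e) = PVar (Some e) * PVar None" for e
    by (simp_all add: \<beta>_def)
  let ?P = "\<Sum>T\<in>spanning_trees \<Gamma>. \<Prod>e\<in>arcs \<Gamma> - T. PVar (Some e) :: ('e option,'k) mpol"
  have "psubst \<beta> lift_poly = (\<Sum>T\<in>spanning_trees \<Gamma>. PVar None ^ ?N * (\<Prod>e\<in>arcs \<Gamma> - T. PVar (Some e)))"
    unfolding lift_poly_def psubst.sum psubst.mult psubst.prod psubst_PVar \<beta>
  proof (rule sum.cong[OF refl])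
    fix T assume T: "T \<in> spanning_trees \<Gamma>"
    have "lift_set T \<subseteq> arcs \<Gamma> - T" using lift_set(1)[OF T] G by auto
    then have "(\<Prod>e\<in>arcs \<Gamma> - T. PVar (Some e) :: ('e option,'k) mpol) =
        (\<Prod>e\<in>lift_set T. PVar (Some e)) * (\<Prod>e\<in>arcs \<Gamma> - T - lift_set T. PVar (Some e))"
      using finite_arcs_\<Gamma> by (subst prod.subset_diff[of "lift_set T"]) (auto simp: mult.commute)
    then show "(\<Prod>e\<in>lift_set T. PVar (Some e) * PVar None) * (\<Prod>e\<in>arcs \<Gamma> - T - lift_set T. PVar (Some e)) =
        PVar None ^ ?N * (\<Prod>e\<in>arcs \<Gamma> - T. PVar (Some e) :: ('e option,'k) mpol)"
      by (simp add: prod.distrib lift_set(2)[OF T] mult_ac)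
  qed
  then have "psubst \<beta> lift_poly = PVar None ^ ?N * ?P" by (simp add: sum_distrib_left)
  moreover have "psubst \<beta> \<Psi> = ?P"
    by (simp add: graph_poly_def psubst.sum psubst.prod \<beta>)
  ultimately have eq: "psubst \<beta> (PVar (Inl g) ^ ?N * lift_poly - PVar (Inr g) ^ ?N * \<Psi>) = 0"
    by (simp add: \<beta> power_mult_distrib mult_ac)
  have "pvars (PVar (Inl g) ^ ?N * lift_poly) \<subseteq> coords (biproj (arcs \<Gamma>) G)"
    using g G by (intro pvars_mult_subset pvars_power_subset pvars_lift_poly) auto
  moreover have "pvars (- (PVar (Inr g) ^ ?N * \<Psi>)) \<subseteq> coords (biproj (arcs \<Gamma>) G)"
    unfolding pvars_uminus using g by (intro pvars_mult_subset pvars_power_subset pvars_\<Psi>) auto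
  ultimately have "pvars (PVar (Inl g) ^ ?N * lift_poly + - (PVar (Inr g) ^ ?N * \<Psi>))
      \<subseteq> coords (biproj (arcs \<Gamma>) G)"
    by (intro pvars_add_subset)
  with eq show ?thesis unfolding blowup_def \<beta>_def by simp
qed

text \<open>The condition over all of \<open>exc_F\<close> reduces to its generators: exponent 1
  works for blowup equations and N for A_g, and \<open>power_add_mult_closed\<close> carries the
  property to sums.\<close>

lemma lift_poly_strict_Y: "lift_poly \<in> strict_Y \<Gamma> G"
proof -
  let ?Bs = "biproj (arcs \<Gamma>) G"
  let ?I = "pideal ?Bs (blowup (arcs \<Gamma>) G PVar \<union> {\<Psi>})"
  note I = total_X_generators
  \<comment> \<open>The bound on variables is part of the induction, since the sum case multiplies
    elements of \<open>?I\<close> by \<open>q1\<close> and \<open>q2\<close>.\<close>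
  have "pvars q \<subseteq> coords ?Bs \<and> (\<exists>n. q ^ n * lift_poly \<in> ?I)" if "q \<in> exc_F \<Gamma> G" for q
    using that exc_F_generators unfolding exc_F_pideal
  proof (induction rule: pideal_induct)
    case (base q)
    then consider "q \<in> blowup (arcs \<Gamma>) G PVar" | g where "g \<in> G" "q = PVar (Inl g)" by auto
    then show ?case
    proof cases
      case 1
      then have "lift_poly * q \<in> ?I"
        using pvars_lift_poly by (intro pideal_mult[OF I] pideal_base[OF I]) auto
      then have "q ^ 1 * lift_poly \<in> ?I" by (simp add: mult.commute)
      then show ?thesis using 1 blowup_subset[of "arcs \<Gamma>" G PVar] by blast
    next
      case 2
      let ?N = "betti \<Gamma> G"
      have "PVar (Inl g) ^ ?N * lift_poly - PVar (Inr g) ^ ?N * \<Psi> \<in> ?I"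
        using lift_poly_blowup[OF 2(1)] by (intro pideal_base[OF I]) auto
      moreover have "PVar (Inr g) ^ ?N * \<Psi> \<in> ?I"
        using pvars_power[of "PVar (Inr g) :: ('e + 'e,'k) mpol" ?N] 2
        by (intro pideal_mult[OF I] pideal_base[OF I]) auto
      ultimately have "q ^ ?N * lift_poly \<in> ?I" using pideal_add[OF I] 2 by fastforce
      moreover have "pvars q \<subseteq> coords ?Bs" using 2 G by auto
      ultimately show ?thesis by blast
    qed
  next
    case zero
    have "0 ^ 1 * lift_poly \<in> ?I" using pideal_0[OF I] by simp
    then show ?case by (metis pvars_0 empty_subsetI)
  next
    case (add q1 q2)
    then obtain n m where nm: "q1 ^ n * lift_poly \<in> ?I" "q2 ^ m * lift_poly \<in> ?I" by blast
    have q: "pvars q1 \<subseteq> coords ?Bs" "pvars q2 \<subseteq> coords ?Bs" using add by blast+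
    have "(q1 + q2) ^ (n + m) * lift_poly \<in> ?I"
      by (rule power_add_mult_closed[of ?I q1 q2, OF pideal_add[OF I]
            pideal_mult[OF I _ q(1)] pideal_mult[OF I _ q(2)] nm])
    then show ?case using add pvars_add[of q1 q2] by blast
  next
    case (mult a q)
    then obtain n where "q ^ n * lift_poly \<in> ?I" by blast
    then have "a ^ n * (q ^ n * lift_poly) \<in> ?I"
      using mult(1) by (intro pideal_mult[OF I, of "q ^ n * lift_poly"] pvars_power_subset)
    then have "(a * q) ^ n * lift_poly \<in> ?I" by (simp add: power_mult_distrib mult.assoc)
    then show ?case using mult pvars_mult[of a q] by blast
  qed
  then show ?thesis
    unfolding strict_Y_def strict_transform_def closure_of_diff_def total_X_pideal
    using pvars_lift_poly by (auto simp: exc_F_def)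
qed

text \<open>Both sides are compared with the principal ideal of
  \<open>\<Psi>\<^sub>G * \<Psi>\<^sub>Q\<close>: the right one equals it, the left one agrees with
  it after dehomogenisation.\<close>

lemma strict_transform_restriction:
  "subsch (biproj G (arcs (contract \<Gamma> G)))
     (inverse_image (biproj G (arcs (contract \<Gamma> G))) (prod_to_F G)
       (pideal (biproj (arcs \<Gamma>) G) (strict_Y \<Gamma> G \<union> exc_F \<Gamma> G))) =
   subsch (biproj G (arcs (contract \<Gamma> G)))
     (pull_fst G (arcs (contract \<Gamma> G)) (X_graph (edge_subgraph \<Gamma> G)) \<inter>
      (pull_snd G (arcs (contract \<Gamma> G)) (X_graph (contract \<Gamma> G)) :: ('e + 'e,'k) mpol set))"
proof -
  let ?Bs = "biproj (arcs \<Gamma>) G" and ?Bs' = "biproj G (arcs \<Gamma> - G)"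
  let ?S = "strict_Y \<Gamma> G \<union> exc_F \<Gamma> G :: ('e + 'e,'k) mpol set"
  have S: "?S \<subseteq> {p. pvars p \<subseteq> coords ?Bs}"
    using pideal_subset[OF exc_F_generators]
    by (auto simp: strict_Y_def strict_transform_def closure_of_diff_def exc_F_pideal)
  have LHS: "inverse_image ?Bs' (prod_to_F G) (pideal ?Bs ?S) = pideal ?Bs' (psubst (prod_to_F G) ` ?S)"
    unfolding inverse_image_def using S by (rule pideal_psubst_pideal) (auto simp: prod_to_F_def split: if_splits)
  have S': "psubst (prod_to_F G) ` ?S \<subseteq> {p. pvars p \<subseteq> coords ?Bs'}"
    using S by (rule psubst_image_subset) (auto simp: prod_to_F_def split: if_splits)
  have fst: "pull_fst G (arcs \<Gamma> - G) (X_graph (edge_subgraph \<Gamma> G)) = pideal ?Bs' {\<Psi>\<^sub>G}"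
    unfolding X_graph_def arcs_edge_subgraph
    by (subst pull_fst_pideal) (use pvars_graph_poly in fastforce)+
  have snd: "pull_snd G (arcs \<Gamma> - G) (X_graph (contract \<Gamma> G)) = pideal ?Bs' {\<Psi>\<^sub>Q}"
    unfolding X_graph_def arcs_contract
    by (subst pull_snd_pideal) (use pvars_graph_poly in fastforce)+
  \<comment> \<open>A common multiple \<open>b * \<Psi>\<^sub>Q\<close> of both factors has
    \<open>b\<close> divisible by \<open>\<Psi>\<^sub>G\<close>, because the two involve disjoint
    variables.\<close>
  have Q: "pideal ?Bs' {\<Psi>\<^sub>G} \<inter> pideal ?Bs' {\<Psi>\<^sub>Q} = pideal ?Bs' {\<Psi>\<^sub>G * \<Psi>\<^sub>Q}"
  proof
    show "pideal ?Bs' {\<Psi>\<^sub>G} \<inter> pideal ?Bs' {\<Psi>\<^sub>Q} \<subseteq> pideal ?Bs' {\<Psi>\<^sub>G * \<Psi>\<^sub>Q}"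
    proof
      fix p assume p: "p \<in> pideal ?Bs' {\<Psi>\<^sub>G} \<inter> pideal ?Bs' {\<Psi>\<^sub>Q}"
      then obtain a b where a: "pvars a \<subseteq> V" "p = a * \<Psi>\<^sub>G" and b: "p = b * \<Psi>\<^sub>Q"
        by (auto simp: pideal_single_iff[OF pvars_\<Psi>\<^sub>G] pideal_single_iff[OF pvars_\<Psi>\<^sub>Q])
      have "\<Psi>\<^sub>G dvd \<Psi>\<^sub>Q * b" using a(2) b by (metis dvd_triv_right mult.commute)
      then have "\<Psi>\<^sub>G dvd b" by (rule dvd_disjoint_cancel) (rule graph_poly_nonzero[OF fin_contract])
      then obtain c where "b = \<Psi>\<^sub>G * c" by (rule dvdE)
      then have c: "p = c * (\<Psi>\<^sub>G * \<Psi>\<^sub>Q)" using b by (simp add: mult_ac)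
      have "pvars p \<subseteq> V" unfolding a(2) by (rule pvars_mult_subset[OF a(1) pvars_\<Psi>\<^sub>G])
      then obtain c' where "pvars c' \<subseteq> V" "p = c' * (\<Psi>\<^sub>G * \<Psi>\<^sub>Q)"
        by (rule dvd_cofactor_pvars[OF c _ pvars_\<Psi>\<^sub>G\<^sub>Q])
      then show "p \<in> pideal ?Bs' {\<Psi>\<^sub>G * \<Psi>\<^sub>Q}"
        using pideal_single_iff[OF pvars_\<Psi>\<^sub>G\<^sub>Q] by blast
    qed
    show "pideal ?Bs' {\<Psi>\<^sub>G * \<Psi>\<^sub>Q} \<subseteq> pideal ?Bs' {\<Psi>\<^sub>G} \<inter> pideal ?Bs' {\<Psi>\<^sub>Q}"
    proof
      fix p assume "p \<in> pideal ?Bs' {\<Psi>\<^sub>G * \<Psi>\<^sub>Q}"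
      then obtain a where a: "pvars a \<subseteq> V" "p = a * (\<Psi>\<^sub>G * \<Psi>\<^sub>Q)"
        using pideal_single_iff[OF pvars_\<Psi>\<^sub>G\<^sub>Q] by blast
      have "pvars (a * \<Psi>\<^sub>Q) \<subseteq> V" "p = (a * \<Psi>\<^sub>Q) * \<Psi>\<^sub>G"
        using a pvars_mult_subset[OF a(1) pvars_\<Psi>\<^sub>Q] by (simp_all add: mult_ac)
      moreover have "pvars (a * \<Psi>\<^sub>G) \<subseteq> V" "p = (a * \<Psi>\<^sub>G) * \<Psi>\<^sub>Q"
        using a pvars_mult_subset[OF a(1) pvars_\<Psi>\<^sub>G] by (simp_all add: mult_ac)
      ultimately show "p \<in> pideal ?Bs' {\<Psi>\<^sub>G} \<inter> pideal ?Bs' {\<Psi>\<^sub>Q}"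
        unfolding Int_iff pideal_single_iff[OF pvars_\<Psi>\<^sub>G] pideal_single_iff[OF pvars_\<Psi>\<^sub>Q] by blast
    qed
  qed
  have "dehom c ` pideal ?Bs' (psubst (prod_to_F G) ` ?S) = dehom c ` pideal ?Bs' {\<Psi>\<^sub>G * \<Psi>\<^sub>Q}"
    if c: "c \<in> listset ?Bs'" for c
  proof
    interpret d: ring_map "dehom c :: ('e + 'e,'k) mpol \<Rightarrow> _" by (rule dehom_ring_map)
    obtain g e where g: "g \<in> G" "c = [Inl g, Inr e]" using c by (auto simp: listset_biproj)
    note P = pideal_single_iff[OF pvars_\<Psi>\<^sub>G\<^sub>Q]
    have PS: "{\<Psi>\<^sub>G * \<Psi>\<^sub>Q} \<subseteq> {p. pvars p \<subseteq> coords ?Bs'}" using pvars_\<Psi>\<^sub>G\<^sub>Q by simp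
    show "dehom c ` pideal ?Bs' (psubst (prod_to_F G) ` ?S) \<subseteq> dehom c ` pideal ?Bs' {\<Psi>\<^sub>G * \<Psi>\<^sub>Q}"
    proof (rule image_subsetI)
      fix x assume "x \<in> pideal ?Bs' (psubst (prod_to_F G) ` ?S)"
      then show "dehom c x \<in> dehom c ` pideal ?Bs' {\<Psi>\<^sub>G * \<Psi>\<^sub>Q}"
        using S'
      proof (induction rule: pideal_induct)
        case (base x)
        then obtain y where y: "x = psubst (prod_to_F G) y" "y \<in> ?S" by auto
        show ?case
        proof (cases "y \<in> exc_F \<Gamma> G")
          case True
          then have "x = 0" using y prod_to_F_exc_F by simp
          then show ?thesis using pideal_0[OF PS] by blast
        next
          case False
          then have "y \<in> strict_Y \<Gamma> G" using y(2) by simp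
          then obtain n h where h: "pvars h \<subseteq> V"
            "PVar (Inl g) ^ n * psubst (prod_to_F G) y = h * (\<Psi>\<^sub>G * \<Psi>\<^sub>Q)"
            using g(1) by (rule strict_Y_restriction)
          \<comment> \<open>The chart selects the coordinate g, which removes the power left over in
            \<open>strict_Y_restriction\<close>.\<close>
          have "dehom c (PVar (Inl g)) = (1 :: ('e + 'e,'k) mpol)" by (simp add: dehom_PVar g(2))
          then have "dehom c (PVar (Inl g) ^ n * psubst (prod_to_F G) y) = dehom c x"
            by (simp add: y(1))
          moreover have "h * (\<Psi>\<^sub>G * \<Psi>\<^sub>Q) \<in> pideal ?Bs' {\<Psi>\<^sub>G * \<Psi>\<^sub>Q}" using h(1) P by blast
          ultimately show ?thesis unfolding h(2) by (metis image_eqI)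
        qed
      next
        case zero
        have "dehom c 0 = (0 :: ('e + 'e,'k) mpol)" by simp
        then show ?case using pideal_0[OF PS] by (metis image_eqI)
      next
        case (add x y)
        then obtain x' y' where "x' \<in> pideal ?Bs' {\<Psi>\<^sub>G * \<Psi>\<^sub>Q}" "y' \<in> pideal ?Bs' {\<Psi>\<^sub>G * \<Psi>\<^sub>Q}"
          "dehom c x = dehom c x'" "dehom c y = dehom c y'" by blast
        then show ?case by (intro image_eqI[of _ _ "x' + y'"] pideal_add[OF PS]) simp_all
      next
        case (mult a x)
        then obtain x' where "x' \<in> pideal ?Bs' {\<Psi>\<^sub>G * \<Psi>\<^sub>Q}" "dehom c x = dehom c x'" by blast
        then show ?case using mult by (intro image_eqI[of _ _ "a * x'"] pideal_mult[OF PS]) simp_all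
      qed
    qed
    \<comment> \<open>This inclusion holds before dehomogenising, since the generator is the
      restriction of \<open>lift_poly\<close>.\<close>
    show "dehom c ` pideal ?Bs' {\<Psi>\<^sub>G * \<Psi>\<^sub>Q} \<subseteq> dehom c ` pideal ?Bs' (psubst (prod_to_F G) ` ?S)"
    proof (intro image_mono subsetI)
      fix p assume "p \<in> pideal ?Bs' {\<Psi>\<^sub>G * \<Psi>\<^sub>Q}"
      then obtain a where "pvars a \<subseteq> V" "p = a * psubst (prod_to_F G) lift_poly"
        using P restriction_lift_poly by auto
      moreover have "psubst (prod_to_F G) lift_poly \<in> psubst (prod_to_F G) ` ?S"
        using lift_poly_strict_Y by blast
      ultimately show "p \<in> pideal ?Bs' (psubst (prod_to_F G) ` ?S)"
        by (metis pideal_mult[OF S'] pideal_base[OF S'])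
    qed
  qed
  then show ?thesis
    unfolding arcs_contract LHS fst snd Q subsch_def by (intro restrict_ext) simp
qed

text \<open>The composite on F differs from the identity only in the coordinates A_g with g in
  \<open>G\<close>, which are equations of F. The composite on the product fixes every
  coordinate.\<close>

lemma isomorphism_exc_F:
  "isomorphism_by
     (biproj (arcs \<Gamma>) G) (exc_F \<Gamma> G :: ('e + 'e,'k) mpol set)
     (biproj G (arcs (contract \<Gamma> G))) {0}
     F_to_prod (prod_to_F G)"
proof -
  let ?Bs = "biproj (arcs \<Gamma>) G" and ?Bs' = "biproj G (arcs \<Gamma> - G)"
  let ?F = "exc_F \<Gamma> G :: ('e + 'e,'k) mpol set"
  have finG: "finite G" by (rule finite_subset[OF G finite_arcs_\<Gamma>])
  have F: "?F \<subseteq> {p. pvars p \<subseteq> coords ?Bs}"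
    unfolding exc_F_pideal by (rule pideal_subset[OF exc_F_generators])
  have AF: "PVar (Inl g) \<in> ?F" if "g \<in> G" for g
    unfolding exc_F_pideal using that by (intro pideal_base[OF exc_F_generators]) auto
  have F0: "0 \<in> ?F" unfolding exc_F_pideal by (rule pideal_0[OF exc_F_generators])
  have "morphism_by ?Bs ?F ?Bs' {0} F_to_prod"
    unfolding morphism_by_def
  proof (intro conjI ballI)
    fix B assume B: "B \<in> set ?Bs'"
    have sub: "?F \<union> F_to_prod ` B \<subseteq> {p. pvars p \<subseteq> coords ?Bs}"
      using F B by (auto simp: biproj_def coords_def F_to_prod_def)
    note base = pideal_base[OF sub]
    from B consider "B = Inl ` G" | "B = Inr ` (arcs \<Gamma> - G)" by (auto simp: biproj_def)
    then have "(\<exists>d. \<forall>w\<in>B. multihom ?Bs d (F_to_prod w :: ('e + 'e,'k) mpol)) \<and>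
      vanishes_on ?Bs (pideal ?Bs (?F \<union> F_to_prod ` B)) 1"
    proof cases
      case 1
      have "vanishes_on ?Bs (pideal ?Bs (?F \<union> F_to_prod ` B)) 1"
      proof (rule vanishes_on_1I)
        fix c assume "c \<in> listset ?Bs"
        then obtain e g where g: "g \<in> G" "c = [Inl e, Inr g]" by (auto simp: listset_biproj)
        have "F_to_prod (Inl g) \<in> F_to_prod ` B" using g by (intro imageI) (auto simp: 1)
        then have "PVar (Inr g) \<in> F_to_prod ` B" by (simp add: F_to_prod_def)
        then show "\<exists>v\<in>set c. PVar v \<in> pideal ?Bs (?F \<union> F_to_prod ` B)"
          using g by (intro bexI[of _ "Inr g"] base) auto
      qed
      then show ?thesis
        using multihom_PVar_Inr[OF finG, of _ "arcs \<Gamma>"] by (auto simp: 1 F_to_prod_def)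
    next
      case 2
      have "vanishes_on ?Bs (pideal ?Bs (?F \<union> F_to_prod ` B)) 1"
      proof (rule vanishes_on_1I)
        fix c assume "c \<in> listset ?Bs"
        then obtain e g where e: "e \<in> arcs \<Gamma>" "c = [Inl e, Inr g]" by (auto simp: listset_biproj)
        \<comment> \<open>On a chart selecting an edge of \<open>G\<close>, F itself is empty, as
          this coordinate is one of its equations. On the others the coordinate is a component of
          the map.\<close>
        have "PVar (Inl e) \<in> ?F \<union> F_to_prod ` B"
        proof (cases "e \<in> G")
          case False
          then have "F_to_prod (Inr e) \<in> F_to_prod ` B" using e(1) by (auto simp: 2)
          moreover have "F_to_prod (Inr e) = PVar (Inl e)" by (simp add: F_to_prod_def)
          ultimately show ?thesis by (metis UnI2)
        qed (simp add: AF)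
        then show "\<exists>v\<in>set c. PVar v \<in> pideal ?Bs (?F \<union> F_to_prod ` B)"
          using e by (intro bexI[of _ "Inl e"] base) auto
      qed
      then show ?thesis
        using multihom_PVar_Inl[OF finite_arcs_\<Gamma>, of _ G] by (auto simp: 2 F_to_prod_def)
    qed
    then show "\<exists>d. \<forall>w\<in>B. multihom ?Bs d (F_to_prod w :: ('e + 'e,'k) mpol)"
      "vanishes_on ?Bs (pideal ?Bs (?F \<union> F_to_prod ` B)) 1" by blast+
  qed (use F0 in \<open>auto intro!: vanishes_onI\<close>)
  moreover have "morphism_by ?Bs' {0} ?Bs ?F (prod_to_F G)"
    unfolding morphism_by_def
  proof (intro conjI ballI)
    fix B assume B: "B \<in> set ?Bs"
    have sub: "{0 :: ('e + 'e,'k) mpol} \<union> prod_to_F G ` B \<subseteq> {p. pvars p \<subseteq> coords ?Bs'}"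
      using B by (auto simp: biproj_def coords_def prod_to_F_def split: if_splits)
    note base = pideal_base[OF sub]
    from B consider "B = Inl ` arcs \<Gamma>" | "B = Inr ` G" by (auto simp: biproj_def)
    then have "(\<exists>d. \<forall>w\<in>B. multihom ?Bs' d (prod_to_F G w :: ('e + 'e,'k) mpol)) \<and>
      vanishes_on ?Bs' (pideal ?Bs' ({0 :: ('e + 'e,'k) mpol} \<union> prod_to_F G ` B)) 1"
    proof cases
      case 1
      have "vanishes_on ?Bs' (pideal ?Bs' ({0 :: ('e + 'e,'k) mpol} \<union> prod_to_F G ` B)) 1"
      proof (rule vanishes_on_1I)
        fix c assume "c \<in> listset ?Bs'"
        then obtain e g where e: "e \<in> arcs \<Gamma> - G" "c = [Inl g, Inr e]" by (auto simp: listset_biproj)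
        have "prod_to_F G (Inl e) \<in> prod_to_F G ` B" using e by (intro imageI) (auto simp: 1)
        then have "PVar (Inr e) \<in> prod_to_F G ` B" using e by (simp add: prod_to_F_def)
        then show "\<exists>v\<in>set c. PVar v \<in> pideal ?Bs' ({0 :: ('e + 'e,'k) mpol} \<union> prod_to_F G ` B)"
          using e by (intro bexI[of _ "Inr e"] base) auto
      qed
      \<comment> \<open>Edges of \<open>G\<close> are sent to 0, which is compatible with the degree
        of the other coordinates by \<open>multihom_0\<close>.\<close>
      moreover have "multihom ?Bs' (\<lambda>i. if i = 1 then 1 else 0) (prod_to_F G w :: ('e + 'e,'k) mpol)"
        if w: "w \<in> B" for w
      proof -
        obtain e where e: "w = Inl e" "e \<in> arcs \<Gamma>" using w 1 by auto
        show ?thesis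
        proof (cases "e \<in> G")
          case False
          then have "prod_to_F G w = (PVar (Inr e) :: ('e + 'e,'k) mpol)" by (simp add: e prod_to_F_def)
          then show ?thesis using False e finite_arcs_\<Gamma> by (simp only:) (rule multihom_PVar_Inr; simp)
        qed (simp add: e prod_to_F_def multihom_0)
      qed
      ultimately show ?thesis by blast
    next
      case 2
      have "vanishes_on ?Bs' (pideal ?Bs' ({0 :: ('e + 'e,'k) mpol} \<union> prod_to_F G ` B)) 1"
      proof (rule vanishes_on_1I)
        fix c assume "c \<in> listset ?Bs'"
        then obtain e g where g: "g \<in> G" "c = [Inl g, Inr e]" by (auto simp: listset_biproj)
        have "prod_to_F G (Inr g) \<in> prod_to_F G ` B" using g by (intro imageI) (auto simp: 2)
        then have "PVar (Inl g) \<in> prod_to_F G ` B" by (simp add: prod_to_F_def)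
        then show "\<exists>v\<in>set c. PVar v \<in> pideal ?Bs' ({0 :: ('e + 'e,'k) mpol} \<union> prod_to_F G ` B)"
          using g by (intro bexI[of _ "Inl g"] base) auto
      qed
      then show ?thesis
        using multihom_PVar_Inl[OF finG, of _ "arcs \<Gamma> - G"] by (auto simp: 2 prod_to_F_def)
    qed
    then show "\<exists>d. \<forall>w\<in>B. multihom ?Bs' d (prod_to_F G w :: ('e + 'e,'k) mpol)"
      "vanishes_on ?Bs' (pideal ?Bs' ({0 :: ('e + 'e,'k) mpol} \<union> prod_to_F G ` B)) 1" by blast+
  qed (auto intro!: vanishes_onI prod_to_F_exc_F)
  moreover have "same_morphism ?Bs ?F ?Bs (psubst F_to_prod \<circ> prod_to_F G) PVar"
  proof -
    have comp: "psubst F_to_prod (prod_to_F G (Inl e)) = (if e \<in> G then 0 else PVar (Inl e) :: ('e + 'e,'k) mpol)"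
      "psubst F_to_prod (prod_to_F G (Inr e)) = (PVar (Inr e) :: ('e + 'e,'k) mpol)" for e
      by (simp_all add: F_to_prod_def prod_to_F_def)
    have AF': "p * PVar (Inl g) \<in> ?F" "- (p * PVar (Inl g)) \<in> ?F"
      "PVar (Inl g) * p \<in> ?F" "- (PVar (Inl g) * p) \<in> ?F"
      if "g \<in> G" "pvars p \<subseteq> coords ?Bs" for g p
      using pideal_mult[OF exc_F_generators, of "PVar (Inl g)" p]
        pideal_mult[OF exc_F_generators, of "PVar (Inl g)" "- p"] AF[OF that(1)] that(2)
      unfolding exc_F_pideal by (auto simp: mult.commute[of _ p])
    show ?thesis
      unfolding same_morphism_def
    proof (intro ballI vanishes_onI)
      fix B v w assume "B \<in> set ?Bs" "v \<in> B" "w \<in> B"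
      then consider e e' where "v = Inl e" "w = Inl e'" "e \<in> arcs \<Gamma>" "e' \<in> arcs \<Gamma>"
        | g g' where "v = Inr g" "w = Inr g'"
        by (auto simp: biproj_def)
      then show "(psubst F_to_prod \<circ> prod_to_F G) v * PVar w - (psubst F_to_prod \<circ> prod_to_F G) w * PVar v \<in> ?F"
        by cases (auto simp: comp F0 mult.commute intro: AF')
    qed
  qed
  moreover have "same_morphism ?Bs' {0} ?Bs' (psubst (prod_to_F G) \<circ> F_to_prod) (PVar :: _ \<Rightarrow> ('e + 'e,'k) mpol)"
    unfolding same_morphism_def
    by (intro ballI vanishes_onI)
       (auto simp: biproj_def F_to_prod_def prod_to_F_def mult.commute)
  ultimately show ?thesis by (simp add: isomorphism_by_def)
qed

text \<open>Since \<open>betti\<close> is positive, each term of the graph polynomial contains some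
  A_g with g in \<open>G\<close>. The resulting inclusion of ideals passes to every chart.\<close>

lemma lin_space_subset_X:
  assumes "h1 (edge_subgraph \<Gamma> G) > 0"
  shows "subsch_le [arcs \<Gamma>] (lin_space (arcs \<Gamma>) G) (X_graph \<Gamma> :: ('e,'k) mpol set)"
proof -
  have L: "(PVar ` G :: ('e,'k) mpol set) \<subseteq> {p. pvars p \<subseteq> coords [arcs \<Gamma>]}" using G by auto
  have "(graph_poly \<Gamma> :: ('e,'k) mpol) \<in> pideal [arcs \<Gamma>] (PVar ` G)"
    unfolding graph_poly_def
  proof (intro pideal_sum[OF L])
    fix T assume T: "T \<in> spanning_trees \<Gamma>"
    have "card (G - T) > 0"
      using card_complement_spanning_tree(1)[OF fin G T] betti_pos[OF fin G assms] by simp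
    then obtain g where g: "g \<in> G" "g \<in> arcs \<Gamma> - T" using G by (auto simp: card_gt_0_iff)
    have "(\<Prod>e\<in>arcs \<Gamma> - T. PVar e) = (\<Prod>e\<in>arcs \<Gamma> - T - {g}. PVar e) * (PVar g :: ('e,'k) mpol)"
      using g finite_arcs_\<Gamma> by (simp add: prod.remove[of _ g] mult.commute)
    also have "\<dots> \<in> pideal [arcs \<Gamma>] (PVar ` G)"
      using g pvars_prod[of PVar "arcs \<Gamma> - T - {g}"]
      by (intro pideal_mult[OF L] pideal_base[OF L]) auto
    finally show "(\<Prod>e\<in>arcs \<Gamma> - T. PVar e) \<in> pideal [arcs \<Gamma>] (PVar ` G :: ('e,'k) mpol set)" .
  qed
  note mem = this
  have "X_graph \<Gamma> \<subseteq> (lin_space (arcs \<Gamma>) G :: ('e,'k) mpol set)"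
  proof
    fix p :: "('e,'k) mpol" assume "p \<in> X_graph \<Gamma>"
    then obtain a where "pvars a \<subseteq> coords [arcs \<Gamma>]" "p = a * graph_poly \<Gamma>"
      unfolding X_graph_def using pideal_single_iff[of _ "[arcs \<Gamma>]", unfolded coords_single, OF pvars_graph_poly]
      by auto
    then show "p \<in> lin_space (arcs \<Gamma>) G"
      using pideal_mult[OF L mem] by (simp only: lin_space_def)
  qed
  then show ?thesis unfolding subsch_le_def subsch_def by auto
qed

end

theorem proposition3p5:
  fixes \<Gamma> :: "('a,'e) pre_digraph" and G :: "'e set"
  assumes "fin_digraph \<Gamma>" and "connected \<Gamma>" and "G \<subseteq> arcs \<Gamma>"
    and "h1 (edge_subgraph \<Gamma> G) > 0"
  shows "subsch_le [arcs \<Gamma>] (lin_space (arcs \<Gamma>) G) (X_graph \<Gamma> :: ('e,'k::field) mpol set) \<and>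
         isomorphism_by
           (biproj (arcs \<Gamma>) G) (exc_F \<Gamma> G :: ('e + 'e,'k) mpol set)
           (biproj G (arcs (contract \<Gamma> G))) {0}
           F_to_prod (prod_to_F G) \<and>
         subsch (biproj G (arcs (contract \<Gamma> G)))
           (inverse_image (biproj G (arcs (contract \<Gamma> G))) (prod_to_F G)
             (pideal (biproj (arcs \<Gamma>) G) (strict_Y \<Gamma> G \<union> exc_F \<Gamma> G))) =
         subsch (biproj G (arcs (contract \<Gamma> G)))
           (pull_fst G (arcs (contract \<Gamma> G)) (X_graph (edge_subgraph \<Gamma> G)) \<inter>
            (pull_snd G (arcs (contract \<Gamma> G)) (X_graph (contract \<Gamma> G)) :: ('e + 'e,'k) mpol set))"
  using lin_space_subset_X[OF assms(1,3,4)] isomorphism_exc_F[OF assms(1,3)]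
    strict_transform_restriction[OF assms(1,3)]
  by blast

end
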